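(* Let Assumptions (A1)–(A5) of the context be satisfied, together with (A6) and (A7), which provide the constants used in the convergence analysis. Then every accumulation point $\bar\mu$ of the sequence $\{\mu^{(k)}\}_{k\in\mathbb N}\subset\mathcal P$ generated by the TR-RB algorithm described in the context is an approximate first-order critical point for $\hat{\mathcal J}_h$, i.e., it holds $$\big\|\bar\mu-\mathrm P_{\mathcal P}\big(\bar\mu-\nabla_\mu\hat{\mathcal J}_h(\bar\mu)\big)\big\|_2=0 .$$
   Context: **Continuous and full order problem.** $V$ is a real Hilbert space with norm $\|\cdot\|$, $V_h\subset V$ a finite-dimensional subspace, $\mathcal P=\{\mu\in\mathbb R^P:\mu_{\mathsf a}\le\mu\le\mu_{\mathsf b}\}$ (componentwise) a compact box. For $\mu\in\mathcal P$: $a_\mu$ is a continuous coercive bilinear form on $V$, $l_\mu,j_\mu$ are continuous linear functionals, $k_\mu$ is a continuous symmetric bilinear form, $\Theta:\mathcal P\to\mathbb R$, and $\mathcal J(u,\mu)=\Theta(\mu)+j_\mu(u)+k_\mu(u,u)$. Residuals: $r^{\rm pr}_\mu(u)[v]=l_\mu(v)-a_\mu(u,v)$ and $r^{\rm du}_\mu(u,p)[q]=j_\mu(q)+2k_\mu(q,u)-a_\mu(q,p)$. The primal and dual solutions $u_\mu,p_\mu\in V$ satisfy $r^{\rm pr}_\mu(u_\mu)[v]=0$ and $r^{\rm du}_\mu(u_\mu,p_\mu)[v]=0$ for all $v\in V$; their discrete counterparts $u_{h,\mu},p_{h,\mu}\in V_h$ satisfy $r^{\rm pr}_\mu(u_{h,\mu})[v]=0$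 and $r^{\rm du}_\mu(u_{h,\mu},p_{h,\mu})[v]=0$ for all $v\in V_h$. For these solutions $d_{\mu_i}$ denotes the derivative with respect to $\mu_i$ (sensitivity), and $d_\eta$ the derivative in direction $\eta$. $\hat{\mathcal J}_h(\mu)=\mathcal J(u_{h,\mu},\mu)$. $\mathrm P_{\mathcal P}$ is the componentwise projection of $\mathbb R^P$ onto $\mathcal P$; $g_h(\mu)=\|\mu-\mathrm P_{\mathcal P}(\mu-\nabla_\mu\hat{\mathcal J}_h(\mu))\|_2$. **Reduced basis (RB) model.** For subspaces $V^{\rm pr}_r,V^{\rm du}_r\subset V_h$, $u_{r,\mu}\in V_r^{\rm pr}$ and $p_{r,\mu}\in V_r^{\rm du}$ solve $r_\mu^{\rm pr}(u_{r,\mu})[v]=0$ for all $v\in V_r^{\rm pr}$ and $r_\mu^{\rm du}(u_{r,\mu},p_{r,\mu})[q]=0$ for all $q\in V_r^{\rm du}$. The NCD-corrected reduced functional is $\hat{\mathcal J}_r(\mu)=\mathcal J(u_{r,\mu},\mu)+r^{\rm pr}_\mu(u_{r,\mu})[p_{r,\mu}]$, with Hessian $\hat{\mathcal H}_{r,\mu}$. Its error bound is $\Delta_{\hat{\mathcal J}_r}(\mu)=\Delta_{\rm pr}(\mu)\|r^{\rm du}_\mu(u_{r,\mu},p_{r,\mu})\|_{V_h'}+\Delta_{\rm pr}(\mu)^2\gamma_{k_\mu}$ with $\Delta_{\rm pr}(\mu)=\underline{a_\mu}^{-1}\|r^{\rm pr}_\mu(u_{r,\mu})\|_{V_h'}$,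 where $\underline{a_\mu}>0$ is the coercivity constant of $a_\mu$ on $V_h$ and $\gamma_{k_\mu}$ the norm of $k_\mu$; it satisfies $|\hat{\mathcal J}_h(\mu)-\hat{\mathcal J}_r(\mu)|\le\Delta_{\hat{\mathcal J}_r}(\mu)$. *Updating the RB model at $\mu$* means adding $u_{h,\mu}$ to $V_r^{\rm pr}$ and $p_{h,\mu}$ to $V_r^{\rm du}$ (in the directional Taylor variant also $d_\eta u_{h,\mu}$ and $d_\eta p_{h,\mu}$, respectively, with $\eta=\nabla_\mu\hat{\mathcal J}_r(\mu)$). The superscript $(k)$ on $\hat{\mathcal J}_r^{(k)}$ etc. refers to the RB spaces in iteration $k$. Put $q^{(k)}(\mu)=\Delta_{\hat{\mathcal J}_r^{(k)}}(\mu)/\hat{\mathcal J}_r^{(k)}(\mu)$ and $g_r^{(k)}(\mu)=\|\mu-\mathrm P_{\mathcal P}(\mu-\nabla_\mu\hat{\mathcal J}^{(k)}_r(\mu))\|_2$. **Line search and AGC point.** Let $\kappa\in(0,1)$, $\kappa_{\mathsf{arm}}=10^{-4}$. For $\mu^{(k,\ell)}\in\mathcal P$ and a direction $d^{(k,\ell)}$ let $\mu^{(k,\ell)}(j)=\mathrm P_{\mathcal P}(\mu^{(k,\ell)}+\kappa^jd^{(k,\ell)})$. The conditions are (Arm) $\hat{\mathcal J}_r^{(k)}(\mu^{(k,\ell)}(j))-\hat{\mathcal J}_r^{(k)}(\mu^{(k,\ell)})\le-\frac{\kappa_{\mathsf{arm}}}{\kappa^j}\|\mu^{(k,\ell)}(j)-\mu^{(k,\ell)}\|_2^2$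 and (TR) $q^{(k)}(\mu^{(k,\ell)}(j))\le\delta^{(k)}$. The approximated generalized Cauchy (AGC) point is $\mu^{(k)}_{\rm AGC}=\mu^{(k,0)}(j_c^{(k)})$ with $\mu^{(k,0)}=\mu^{(k)}$, $d^{(k,0)}=-\nabla_\mu\hat{\mathcal J}_r^{(k)}(\mu^{(k)})$ and $j_c^{(k)}$ the smallest non-negative integer $j$ for which (Arm) and (TR) hold with $\ell=0$. **Sub-problem.** $\min_{\tilde\mu\in\mathcal P}\hat{\mathcal J}^{(k)}_r(\tilde\mu)$ s.t. $q^{(k)}(\tilde\mu)\le\delta^{(k)}$. It is treated by a projected Newton method started at $\mu^{(k,1)}=\mu^{(k)}_{\rm AGC}$, with directions $d^{(k,\ell)}=-(\mathcal R_r^{(k)}(\mu^{(k,\ell)}))^{-1}\nabla_\mu\hat{\mathcal J}_r^{(k)}(\mu^{(k,\ell)})$, where $(\mathcal R_r^{(k)}(\mu))_{ij}$ is the Kronecker delta $\delta_{ij}$ if $i$ or $j$ lies in the $\varepsilon$-active set $\{i:(\mu_{\mathsf b})_i-\mu_i\le\varepsilon\text{ or }\mu_i-(\mu_{\mathsf a})_i\le\varepsilon\}$ and $(\hat{\mathcal H}_{r,\mu}(\mu))_{ij}$ otherwise; $d^{(k,\ell)}$ is computed by truncated CG (stopped on negative curvature), which ensures a descent direction. One sets $\mu^{(k,\ell+1)}=\mu^{(k,\ell)}(j)$ for the smallest $j$ satisfying (Arm) and (TR). The method stops when $\|\mu^{(k,\ell)}-\mathrm P_{\mathcal P}(\mu^{(k,\ell)}-\nabla_\mu\hat{\mathcal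 J}_r^{(k)}(\mu^{(k,\ell)}))\|_2\le\tau_{\rm sub}$ or $\beta_2\delta^{(k)}\le q^{(k)}(\mu^{(k,\ell)})\le\delta^{(k)}$; the last iterate is $\mu^{(k+1)}$. **Skip flag.** $\mathrm{Skip}(k)$ is true iff $q^{(k)}(\mu^{(k+1)})\le\beta_3\delta^{(k+1)}$, and $|g_h(\mu^{(k+1)})-g_r^{(k)}(\mu^{(k+1)})|/g_r^{(k)}(\mu^{(k+1)})\le\tau_g$, and $\|\nabla_\mu\hat{\mathcal J}_h(\mu^{(k+1)})-\nabla_\mu\hat{\mathcal J}_r^{(k)}(\mu^{(k+1)})\|_2/\|\nabla_\mu\hat{\mathcal J}_h(\mu^{(k+1)})\|_2\le\min\{\tau_{\rm grad},\beta_3\delta^{(k+1)}\}$. Also $\varrho^{(k)}=\dfrac{\hat{\mathcal J}_h(\mu^{(k)})-\hat{\mathcal J}_h(\mu^{(k+1)})}{\hat{\mathcal J}_r^{(k)}(\mu^{(k)})-\hat{\mathcal J}_r^{(k)}(\mu^{(k+1)})}$. **TR-RB algorithm.** Parameters: shrinking factor $\beta_1\in(0,1)$; $\beta_2,\beta_3,\tau_{\rm sub},\tau_{\rm grad}\in(0,1)$, $\tau_g>0$, $\eta_\varrho\in[3/4,1)$, $0<\delta_{\min}\ll1$, a stopping tolerance $\tau_{\rm FOC}$, an initial radius $\delta^{(0)}$ and $\mu^{(0)}\in\mathcal P$. Initialize the RB model at $\mu^{(0)}$ ($V_r^{\rm pr}$ spanned by $u_{h,\mu^{(0)}}$, $V_r^{\rm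 du}$ by $p_{h,\mu^{(0)}}$), $k=0$. Repeat: 1. Compute $\mu^{(k)}_{\rm AGC}$. 2. Compute $\mu^{(k+1)}$ from the sub-problem. 3. (i) If $\hat{\mathcal J}_r^{(k)}(\mu^{(k+1)})+\Delta_{\hat{\mathcal J}_r^{(k)}}(\mu^{(k+1)})<\hat{\mathcal J}_r^{(k)}(\mu^{(k)}_{\rm AGC})$: accept $\mu^{(k+1)}$, set $\delta^{(k+1)}=\delta^{(k)}$. If $g_h(\mu^{(k+1)})\le\tau_{\rm FOC}$, stop. Otherwise, if $\varrho^{(k)}\ge\eta_\varrho$ set $\delta^{(k+1)}=\beta_1^{-1}\delta^{(k)}$; then, if not $\mathrm{Skip}(k)$, update the RB model at $\mu^{(k+1)}$. (ii) Else if $\hat{\mathcal J}_r^{(k)}(\mu^{(k+1)})-\Delta_{\hat{\mathcal J}_r^{(k)}}(\mu^{(k+1)})>\hat{\mathcal J}_r^{(k)}(\mu^{(k)}_{\rm AGC})$: if $\beta_1\delta^{(k)}\le\delta_{\min}$ or $\mathrm{Skip}(k-1)$, update the RB model at $\mu^{(k+1)}$. Reject $\mu^{(k+1)}$, shrink the radius $\delta^{(k+1)}=\beta_1\delta^{(k)}$ and go to 2. (iii) Else: set $\delta^{(k+1)}=\beta_1^{-1}\delta^{(k)}$. If $g_h(\mu^{(k+1)})\le\tau_{\rm FOC}$, stop. Otherwise: if $\mathrm{Skip}(k)$ and $\varrho^{(k)}\ge\eta_\varrho$, accept $\mu^{(k+1)}$; else if $\hat{\mathcal J}_h(\mu^{(k+1)})\le\hat{\mathcal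 J}^{(k)}_r(\mu^{(k)}_{\rm AGC})$, accept $\mu^{(k+1)}$, update the RB model, and if $\varrho^{(k)}<\eta_\varrho$ set $\delta^{(k+1)}=\delta^{(k)}$; else, if $\beta_1\delta^{(k)}\le\delta_{\min}$ or $\mathrm{Skip}(k-1)$, update the RB model at $\mu^{(k+1)}$, and then reject $\mu^{(k+1)}$, set $\delta^{(k+1)}=\beta_1\delta^{(k)}$ and go to 2. 4. $k\leftarrow k+1$. **Assumptions.** (A1) $a_\mu,l_\mu,j_\mu,k_\mu$ are parameter separable: finite sums $\sum_i\theta_i(\mu)\,b_i$ with non-parametric (bi)linear forms $b_i$ and parameter functionals $\theta_i$ on $\mathcal P$. (A2) $a_\mu,l_\mu,\mathcal J$ are twice continuously Fréchet differentiable w.r.t. $\mu$ (so the coefficient functions in (A1) are twice continuously differentiable), and all $\mu$-dependent functions have locally Lipschitz-continuous second derivatives. (A3) ("truth") The discretization errors $\|u_\mu-u_{h,\mu}\|$, $\|p_\mu-p_{h,\mu}\|$, $\|d_{\mu_i}u_\mu-d_{\mu_i}u_{h,\mu}\|$ and $\|d_{\mu_i}p_\mu-d_{\mu_i}p_{h,\mu}\|$ are negligible for all $\mu\in\mathcal P$, $1\le i\le P$. (A4) $\mathcal J(u,\mu)>0$ for all $u\in V$, $\mu\in\mathcal P$. (A5) For each $k\ge0$ there exists a radius $\delta^{(k)}>\tau_{\rm mac}>0$ ($\tau_{\rm mac}$ being the double machine precision) for which there is a solution $\mu^{(k+1)}$ of the sub-problem satisfying the error-aware sufficient decrease condition $\hat{\mathcal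 J}_r^{(k+1)}(\mu^{(k+1)})\le\hat{\mathcal J}_r^{(k)}(\mu_{\rm AGC}^{(k)})$. (A6) There is $C_L>0$ independent of $k$ with $\|\nabla_\mu\hat{\mathcal J}_r^{(k)}(\mu)-\nabla_\mu\hat{\mathcal J}_r^{(k)}(\nu)\|_2\le C_L\|\mu-\nu\|_2$ for all $\mu,\nu\in\mathcal P$, $k\in\mathbb N$; similarly, the second derivatives of $\hat{\mathcal J}_r^{(k)}$ are locally Lipschitz-continuous. (A7) $q^{(k)}:\mathcal P\to\mathbb R$ is uniformly continuous uniformly in $k$: for every $\varepsilon>0$ there is $\eta(\varepsilon)>0$ such that for all $\mu,\nu\in\mathcal P$, $\|\mu-\nu\|_2<\eta(\varepsilon)$ implies $|q^{(k)}(\mu)-q^{(k)}(\nu)|<\varepsilon$. *)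

theory Defs
  imports "HOL-Analysis.Analysis"
begin

section \<open>Calculus on a box\<close>

text \<open>
  The parameter domain is the closed box \<open>cbox lo hi\<close>, and parameter-dependent quantities only
  matter on it, so every derivative is taken within the box (one-sided at the boundary).
  In a direction in which the box is degenerate the partial derivative carries no information and
  is fixed to be \<open>0\<close>. The componentwise projection onto the box is the library's \<open>clamp lo hi\<close>.
\<close>

definition pdiff ::
  "real^'p \<Rightarrow> real^'p \<Rightarrow> (real^'p \<Rightarrow> 'b::real_normed_vector) \<Rightarrow> 'p::finite \<Rightarrow> real^'p \<Rightarrow> 'b" where
  "pdiff lo hi f i \<mu> =
     (if lo $ i = hi $ i then 0
      else vector_derivative (\<lambda>t. f (\<mu> + t *\<^sub>R axis i 1))
             (at 0 within {t. \<mu> + t *\<^sub>R axis i 1 \<in> cbox lo hi}))"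

text \<open>
  The directional derivative is the linear expression in the partial derivatives: at boundary
  points neither \<open>\<eta>\<close> nor \<open>-\<eta>\<close> need point into the box.
\<close>

definition ddiff ::
  "real^'p \<Rightarrow> real^'p \<Rightarrow> (real^'p \<Rightarrow> 'b::real_normed_vector) \<Rightarrow> real^'p \<Rightarrow> real^'p::finite \<Rightarrow> 'b" where
  "ddiff lo hi f \<eta> \<mu> = (\<Sum>i\<in>UNIV. (\<eta> $ i) *\<^sub>R pdiff lo hi f i \<mu>)"

definition grad :: "real^'p \<Rightarrow> real^'p \<Rightarrow> (real^'p \<Rightarrow> real) \<Rightarrow> real^'p \<Rightarrow> real^'p::finite" where
  "grad lo hi f \<mu> = (\<chi> i. pdiff lo hi f i \<mu>)"

definition hess :: "real^'p \<Rightarrow> real^'p \<Rightarrow> (real^'p \<Rightarrow> real) \<Rightarrow> real^'p \<Rightarrow> real^'p^'p::finite" where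
  "hess lo hi f \<mu> = (\<chi> i j. pdiff lo hi (pdiff lo hi f j) i \<mu>)"

definition crit :: "real^'p \<Rightarrow> real^'p \<Rightarrow> (real^'p \<Rightarrow> real) \<Rightarrow> real^'p::finite \<Rightarrow> real" where
  "crit lo hi f \<mu> = norm (\<mu> - clamp lo hi (\<mu> - grad lo hi f \<mu>))"

text \<open>
  Twice continuously Frechet differentiable on \<open>S\<close>, with locally Lipschitz second derivative.
\<close>

definition C2_loclip_on :: "'a::real_normed_vector set \<Rightarrow> ('a \<Rightarrow> real) \<Rightarrow> bool" where
  "C2_loclip_on S f \<longleftrightarrow>
     (\<exists>(f' :: 'a \<Rightarrow> 'a \<Rightarrow>\<^sub>L real) (f'' :: 'a \<Rightarrow> 'a \<Rightarrow>\<^sub>L 'a \<Rightarrow>\<^sub>L real).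
        (\<forall>x\<in>S. (f has_derivative blinfun_apply (f' x)) (at x within S)) \<and>
        (\<forall>x\<in>S. (f' has_derivative blinfun_apply (f'' x)) (at x within S)) \<and>
        continuous_on S f'' \<and>
        (\<forall>x\<in>S. \<exists>r>0. \<exists>L. L-lipschitz_on (cball x r \<inter> S) f''))"


section \<open>Full order problem\<close>

record ('v, 'p::finite) problem =
  Vh :: "'v set"
  mu_lo :: "real^'p"
  mu_hi :: "real^'p"
  form_a :: "real^'p \<Rightarrow> 'v \<Rightarrow> 'v \<Rightarrow> real"
  form_l :: "real^'p \<Rightarrow> 'v \<Rightarrow> real"
  form_j :: "real^'p \<Rightarrow> 'v \<Rightarrow> real"
  form_k :: "real^'p \<Rightarrow> 'v \<Rightarrow> 'v \<Rightarrow> real"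
  Theta :: "real^'p \<Rightarrow> real"

abbreviation Pset :: "('v, 'p::finite) problem \<Rightarrow> (real^'p) set" where
  "Pset D \<equiv> cbox (mu_lo D) (mu_hi D)"

abbreviation proj :: "('v, 'p::finite) problem \<Rightarrow> real^'p \<Rightarrow> real^'p" where
  "proj D \<equiv> clamp (mu_lo D) (mu_hi D)"

definition coercive :: "('v::real_normed_vector \<Rightarrow> 'v \<Rightarrow> real) \<Rightarrow> bool" where
  "coercive b \<longleftrightarrow> (\<exists>\<alpha>>0. \<forall>u. \<alpha> * (norm u)\<^sup>2 \<le> b u u)"

definition wf_problem :: "('v::{real_inner,complete_space}, 'p::finite) problem \<Rightarrow> bool" where
  "wf_problem D \<longleftrightarrow>
     subspace (Vh D) \<and> (\<exists>B. finite B \<and> span B = Vh D) \<and>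
     (\<forall>i. mu_lo D $ i \<le> mu_hi D $ i) \<and>
     (\<forall>\<mu>\<in>Pset D.
        bounded_bilinear (form_a D \<mu>) \<and> coercive (form_a D \<mu>) \<and>
        bounded_linear (form_l D \<mu>) \<and> bounded_linear (form_j D \<mu>) \<and>
        bounded_bilinear (form_k D \<mu>) \<and> (\<forall>u v. form_k D \<mu> u v = form_k D \<mu> v u))"

definition cost :: "('v, 'p::finite) problem \<Rightarrow> 'v \<Rightarrow> real^'p \<Rightarrow> real" where
  "cost D u \<mu> = Theta D \<mu> + form_j D \<mu> u + form_k D \<mu> u u"

definition r_pr :: "('v, 'p::finite) problem \<Rightarrow> real^'p \<Rightarrow> 'v \<Rightarrow> 'v \<Rightarrow> real" where
  "r_pr D \<mu> u v = form_l D \<mu> v - form_a D \<mu> u v"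

definition r_du :: "('v, 'p::finite) problem \<Rightarrow> real^'p \<Rightarrow> 'v \<Rightarrow> 'v \<Rightarrow> 'v \<Rightarrow> real" where
  "r_du D \<mu> u p q = form_j D \<mu> q + 2 * form_k D \<mu> q u - form_a D \<mu> q p"

text \<open>
  Galerkin solutions in a subspace \<open>W\<close>, unique by coercivity: \<open>W = UNIV\<close> is the continuous
  problem, \<open>W = Vh D\<close> the full order one, and the reduced spaces give the RB solutions.
\<close>

definition primal :: "('v, 'p::finite) problem \<Rightarrow> 'v set \<Rightarrow> real^'p \<Rightarrow> 'v" where
  "primal D W \<mu> = (THE u. u \<in> W \<and> (\<forall>v\<in>W. r_pr D \<mu> u v = 0))"

definition dual :: "('v, 'p::finite) problem \<Rightarrow> 'v set \<Rightarrow> 'v \<Rightarrow> real^'p \<Rightarrow> 'v" where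
  "dual D W u \<mu> = (THE p. p \<in> W \<and> (\<forall>q\<in>W. r_du D \<mu> u p q = 0))"

definition u_ex :: "('v, 'p::finite) problem \<Rightarrow> real^'p \<Rightarrow> 'v" where
  "u_ex D \<mu> = primal D UNIV \<mu>"

definition p_ex :: "('v, 'p::finite) problem \<Rightarrow> real^'p \<Rightarrow> 'v" where
  "p_ex D \<mu> = dual D UNIV (u_ex D \<mu>) \<mu>"

definition u_h :: "('v, 'p::finite) problem \<Rightarrow> real^'p \<Rightarrow> 'v" where
  "u_h D \<mu> = primal D (Vh D) \<mu>"

definition p_h :: "('v, 'p::finite) problem \<Rightarrow> real^'p \<Rightarrow> 'v" where
  "p_h D \<mu> = dual D (Vh D) (u_h D \<mu>) \<mu>"

definition J_h :: "('v, 'p::finite) problem \<Rightarrow> real^'p \<Rightarrow> real" where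
  "J_h D \<mu> = cost D (u_h D \<mu>) \<mu>"

abbreviation pd ::
  "('v, 'p::finite) problem \<Rightarrow> (real^'p \<Rightarrow> 'b::real_normed_vector) \<Rightarrow> 'p \<Rightarrow> real^'p \<Rightarrow> 'b" where
  "pd D \<equiv> pdiff (mu_lo D) (mu_hi D)"

abbreviation nabla :: "('v, 'p::finite) problem \<Rightarrow> (real^'p \<Rightarrow> real) \<Rightarrow> real^'p \<Rightarrow> real^'p" where
  "nabla D \<equiv> grad (mu_lo D) (mu_hi D)"

definition g_h :: "('v, 'p::finite) problem \<Rightarrow> real^'p \<Rightarrow> real" where
  "g_h D = crit (mu_lo D) (mu_hi D) (J_h D)"

text \<open>
  Parameter separability together with the regularity of the coefficient functions: the two
  requirements concern the same decomposition.
\<close>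

definition separable_linear ::
  "(real^'p::finite) set \<Rightarrow> (real^'p \<Rightarrow> 'v::real_vector \<Rightarrow> real) \<Rightarrow> bool" where
  "separable_linear S f \<longleftrightarrow>
     (\<exists>(Q::nat) \<theta> b. (\<forall>i<Q. linear (b i) \<and> C2_loclip_on S (\<theta> i)) \<and>
        (\<forall>\<mu>\<in>S. \<forall>v. f \<mu> v = (\<Sum>i<Q. \<theta> i \<mu> * b i v)))"

definition separable_bilinear ::
  "(real^'p::finite) set \<Rightarrow> (real^'p \<Rightarrow> 'v::real_vector \<Rightarrow> 'v \<Rightarrow> real) \<Rightarrow> bool" where
  "separable_bilinear S f \<longleftrightarrow>
     (\<exists>(Q::nat) \<theta> b. (\<forall>i<Q. bilinear (b i) \<and> C2_loclip_on S (\<theta> i)) \<and>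
        (\<forall>\<mu>\<in>S. \<forall>u v. f \<mu> u v = (\<Sum>i<Q. \<theta> i \<mu> * b i u v)))"

definition separable_smooth :: "('v::real_inner, 'p::finite) problem \<Rightarrow> bool" where
  "separable_smooth D \<longleftrightarrow>
     separable_bilinear (Pset D) (form_a D) \<and> separable_linear (Pset D) (form_l D) \<and>
     separable_linear (Pset D) (form_j D) \<and> separable_bilinear (Pset D) (form_k D) \<and>
     C2_loclip_on (Pset D) (Theta D)"

text \<open>
  ``Negligible'' discretization errors: bounded by a prescribed tolerance \<open>\<epsilon>\<close>.
\<close>

definition truth_error_le :: "('v::real_inner, 'p::finite) problem \<Rightarrow> real \<Rightarrow> bool" where
  "truth_error_le D \<epsilon> \<longleftrightarrow>
     (\<forall>\<mu>\<in>Pset D.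
        norm (u_ex D \<mu> - u_h D \<mu>) \<le> \<epsilon> \<and> norm (p_ex D \<mu> - p_h D \<mu>) \<le> \<epsilon> \<and>
        (\<forall>i. norm (pd D (u_ex D) i \<mu> - pd D (u_h D) i \<mu>) \<le> \<epsilon> \<and>
             norm (pd D (p_ex D) i \<mu> - pd D (p_h D) i \<mu>) \<le> \<epsilon>))"


section \<open>Reduced basis model\<close>

text \<open>A model is the pair of the primal and the dual reduced space.\<close>

type_synonym 'v rb = "'v set \<times> 'v set"

definition u_r :: "('v, 'p::finite) problem \<Rightarrow> 'v rb \<Rightarrow> real^'p \<Rightarrow> 'v" where
  "u_r D M \<mu> = primal D (fst M) \<mu>"

definition p_r :: "('v, 'p::finite) problem \<Rightarrow> 'v rb \<Rightarrow> real^'p \<Rightarrow> 'v" where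
  "p_r D M \<mu> = dual D (snd M) (u_r D M \<mu>) \<mu>"

definition J_r :: "('v, 'p::finite) problem \<Rightarrow> 'v rb \<Rightarrow> real^'p \<Rightarrow> real" where
  "J_r D M \<mu> = cost D (u_r D M \<mu>) \<mu> + r_pr D \<mu> (u_r D M \<mu>) (p_r D M \<mu>)"

definition g_r :: "('v, 'p::finite) problem \<Rightarrow> 'v rb \<Rightarrow> real^'p \<Rightarrow> real" where
  "g_r D M = crit (mu_lo D) (mu_hi D) (J_r D M)"

definition dual_norm :: "'v::real_normed_vector set \<Rightarrow> ('v \<Rightarrow> real) \<Rightarrow> real" where
  "dual_norm W f = (SUP v\<in>W. \<bar>f v\<bar> / norm v)"

definition coercivity_const :: "'v::real_normed_vector set \<Rightarrow> ('v \<Rightarrow> 'v \<Rightarrow> real) \<Rightarrow> real" where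
  "coercivity_const W b = (INF v\<in>W - {0}. b v v / (norm v)\<^sup>2)"

definition bilinear_norm :: "('v::real_normed_vector \<Rightarrow> 'v \<Rightarrow> real) \<Rightarrow> real" where
  "bilinear_norm b = (SUP (u, v)\<in>UNIV. \<bar>b u v\<bar> / (norm u * norm v))"

definition Delta_pr :: "('v::real_inner, 'p::finite) problem \<Rightarrow> 'v rb \<Rightarrow> real^'p \<Rightarrow> real" where
  "Delta_pr D M \<mu> =
     dual_norm (Vh D) (r_pr D \<mu> (u_r D M \<mu>)) / coercivity_const (Vh D) (form_a D \<mu>)"

definition Delta_J :: "('v::real_inner, 'p::finite) problem \<Rightarrow> 'v rb \<Rightarrow> real^'p \<Rightarrow> real" where
  "Delta_J D M \<mu> =
     Delta_pr D M \<mu> * dual_norm (Vh D) (r_du D \<mu> (u_r D M \<mu>) (p_r D M \<mu>))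
     + (Delta_pr D M \<mu>)\<^sup>2 * bilinear_norm (form_k D \<mu>)"

definition q_r :: "('v::real_inner, 'p::finite) problem \<Rightarrow> 'v rb \<Rightarrow> real^'p \<Rightarrow> real" where
  "q_r D M \<mu> = Delta_J D M \<mu> / J_r D M \<mu>"

definition rb_init :: "('v::real_vector, 'p::finite) problem \<Rightarrow> real^'p \<Rightarrow> 'v rb" where
  "rb_init D \<mu> = (span {u_h D \<mu>}, span {p_h D \<mu>})"

text \<open>
  The flag selects the directional Taylor variant; its direction is the gradient of the functional
  of the model before the update.
\<close>

definition rb_update ::
  "('v::real_normed_vector, 'p::finite) problem \<Rightarrow> bool \<Rightarrow> 'v rb \<Rightarrow> real^'p \<Rightarrow> 'v rb" where
  "rb_update D taylor M \<mu> =
     (let \<eta> = nabla D (J_r D M) \<mu>;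
          du = ddiff (mu_lo D) (mu_hi D) (u_h D) \<eta> \<mu>;
          dp = ddiff (mu_lo D) (mu_hi D) (p_h D) \<eta> \<mu>
      in (span (fst M \<union> {u_h D \<mu>} \<union> (if taylor then {du} else {})),
          span (snd M \<union> {p_h D \<mu>} \<union> (if taylor then {dp} else {}))))"


section \<open>Trust-region algorithm\<close>

record ('p::finite) alg_par =
  taylor :: bool
  kappa :: real
  beta1 :: real
  beta2 :: real
  beta3 :: real
  tau_sub :: real
  tau_grad :: real
  tau_g :: real
  eta_rho :: real
  delta_min :: real
  eps_active :: real
  tau_FOC :: real
  delta_init :: real
  mu_init :: "real^'p"

text \<open>
  No sign is imposed on \<open>tau_FOC\<close>: the iteration only continues while \<open>g_h > tau_FOC\<close>, so a
  nonpositive tolerance is what makes infinite runs possible.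
\<close>

definition wf_par :: "('v, 'p::finite) problem \<Rightarrow> 'p alg_par \<Rightarrow> bool" where
  "wf_par D A \<longleftrightarrow>
     kappa A \<in> {0<..<1} \<and> beta1 A \<in> {0<..<1} \<and> beta2 A \<in> {0<..<1} \<and> beta3 A \<in> {0<..<1} \<and>
     tau_sub A \<in> {0<..<1} \<and> tau_grad A \<in> {0<..<1} \<and> tau_g A > 0 \<and> eta_rho A \<in> {3/4..<1} \<and>
     delta_min A \<in> {0<..<1} \<and> delta_init A > 0 \<and> mu_init A \<in> Pset D"

definition kappa_arm :: real where
  "kappa_arm = 1 / 10 ^ 4"

definition ls_point ::
  "('v, 'p::finite) problem \<Rightarrow> 'p alg_par \<Rightarrow> real^'p \<Rightarrow> real^'p \<Rightarrow> nat \<Rightarrow> real^'p" where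
  "ls_point D A \<mu> d j = proj D (\<mu> + kappa A ^ j *\<^sub>R d)"

definition arm_tr ::
  "('v::real_inner, 'p::finite) problem \<Rightarrow> 'p alg_par \<Rightarrow> 'v rb \<Rightarrow> real
     \<Rightarrow> real^'p \<Rightarrow> real^'p \<Rightarrow> nat \<Rightarrow> bool" where
  "arm_tr D A M \<delta> \<mu> d j \<longleftrightarrow>
     J_r D M (ls_point D A \<mu> d j) - J_r D M \<mu>
       \<le> - (kappa_arm / kappa A ^ j) * (norm (ls_point D A \<mu> d j - \<mu>))\<^sup>2 \<and>
     q_r D M (ls_point D A \<mu> d j) \<le> \<delta>"

text \<open>\<open>\<nu>\<close> is the point for the smallest exponent satisfying both line search conditions.\<close>

definition line_search ::
  "('v::real_inner, 'p::finite) problem \<Rightarrow> 'p alg_par \<Rightarrow> 'v rb \<Rightarrow> real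
     \<Rightarrow> real^'p \<Rightarrow> real^'p \<Rightarrow> real^'p \<Rightarrow> bool" where
  "line_search D A M \<delta> \<mu> d \<nu> \<longleftrightarrow>
     (\<exists>j. arm_tr D A M \<delta> \<mu> d j \<and> (\<forall>i<j. \<not> arm_tr D A M \<delta> \<mu> d i) \<and> \<nu> = ls_point D A \<mu> d j)"

definition is_AGC ::
  "('v::real_inner, 'p::finite) problem \<Rightarrow> 'p alg_par \<Rightarrow> 'v rb \<Rightarrow> real
     \<Rightarrow> real^'p \<Rightarrow> real^'p \<Rightarrow> bool" where
  "is_AGC D A M \<delta> \<mu> \<nu> \<longleftrightarrow> line_search D A M \<delta> \<mu> (- nabla D (J_r D M) \<mu>) \<nu>"

text \<open>
  Conjugate gradients for \<open>B d = b\<close> from \<open>0\<close>; a state is (iterate, residual, search direction).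
  The truncated method halts as soon as the residual vanishes or the search direction has
  nonpositive curvature. It returns the current iterate, or \<open>b\<close> if it halts at the start. Unless
  nonpositive curvature is met, the result solves \<open>B d = b\<close>.
\<close>

primrec cg :: "real^'n^'n \<Rightarrow> real^'n \<Rightarrow> nat \<Rightarrow> (real^'n) \<times> (real^'n) \<times> (real^'n::finite)" where
  "cg B b 0 = (0, b, b)"
| "cg B b (Suc n) =
     (let (x, r, s) = cg B b n;
          \<alpha> = (r \<bullet> r) / (s \<bullet> (B *v s));
          r' = r - \<alpha> *\<^sub>R (B *v s)
      in (x + \<alpha> *\<^sub>R s, r', r' + ((r' \<bullet> r') / (r \<bullet> r)) *\<^sub>R s))"

definition cg_halt :: "real^'n^'n \<Rightarrow> (real^'n) \<times> (real^'n) \<times> (real^'n::finite) \<Rightarrow> bool" where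
  "cg_halt B S \<longleftrightarrow> (case S of (x, r, s) \<Rightarrow> r = 0 \<or> s \<bullet> (B *v s) \<le> 0)"

definition truncated_cg :: "real^'n^'n \<Rightarrow> real^'n \<Rightarrow> real^'n::finite \<Rightarrow> bool" where
  "truncated_cg B b d \<longleftrightarrow>
     (\<exists>n. cg_halt B (cg B b n) \<and> (\<forall>m<n. \<not> cg_halt B (cg B b m)) \<and>
          d = (if n = 0 then b else fst (cg B b n)))"

definition active_set :: "('v, 'p::finite) problem \<Rightarrow> real \<Rightarrow> real^'p \<Rightarrow> 'p set" where
  "active_set D \<epsilon> \<mu> = {i. mu_hi D $ i - \<mu> $ i \<le> \<epsilon> \<or> \<mu> $ i - mu_lo D $ i \<le> \<epsilon>}"

definition reduced_hess ::
  "('v, 'p::finite) problem \<Rightarrow> 'p alg_par \<Rightarrow> 'v rb \<Rightarrow> real^'p \<Rightarrow> real^'p^'p" where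
  "reduced_hess D A M \<mu> =
     (\<chi> i j. if i \<in> active_set D (eps_active A) \<mu> \<or> j \<in> active_set D (eps_active A) \<mu>
            then (if i = j then 1 else 0)
            else hess (mu_lo D) (mu_hi D) (J_r D M) \<mu> $ i $ j)"

definition sub_stop ::
  "('v::real_inner, 'p::finite) problem \<Rightarrow> 'p alg_par \<Rightarrow> 'v rb \<Rightarrow> real \<Rightarrow> real^'p \<Rightarrow> bool" where
  "sub_stop D A M \<delta> \<mu> \<longleftrightarrow>
     g_r D M \<mu> \<le> tau_sub A \<or> (beta2 A * \<delta> \<le> q_r D M \<mu> \<and> q_r D M \<mu> \<le> \<delta>)"

text \<open>\<open>proj_newton D A M \<delta> \<mu> \<nu>\<close>: the projected Newton method started at \<open>\<mu>\<close> stops at \<open>\<nu>\<close>.\<close>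

inductive proj_newton ::
  "('v::real_inner, 'p::finite) problem \<Rightarrow> 'p alg_par \<Rightarrow> 'v rb \<Rightarrow> real
     \<Rightarrow> real^'p \<Rightarrow> real^'p \<Rightarrow> bool"
  for D A M \<delta> where
  stop: "sub_stop D A M \<delta> \<mu> \<Longrightarrow> proj_newton D A M \<delta> \<mu> \<mu>"
| step: "\<not> sub_stop D A M \<delta> \<mu> \<Longrightarrow>
         truncated_cg (reduced_hess D A M \<mu>) (- nabla D (J_r D M) \<mu>) d \<Longrightarrow>
         line_search D A M \<delta> \<mu> d \<mu>' \<Longrightarrow>
         proj_newton D A M \<delta> \<mu>' \<nu> \<Longrightarrow>
         proj_newton D A M \<delta> \<mu> \<nu>"

text \<open>
  A relative error with vanishing denominator is undefined and does not count as small; this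
  excludes the convention \<open>x / 0 = 0\<close>.
\<close>

definition Skip ::
  "('v::real_inner, 'p::finite) problem \<Rightarrow> 'p alg_par \<Rightarrow> 'v rb \<Rightarrow> real^'p \<Rightarrow> real \<Rightarrow> bool" where
  "Skip D A M \<mu>' \<delta>' \<longleftrightarrow>
     q_r D M \<mu>' \<le> beta3 A * \<delta>' \<and>
     (g_r D M \<mu>' \<noteq> 0 \<and> \<bar>g_h D \<mu>' - g_r D M \<mu>'\<bar> / g_r D M \<mu>' \<le> tau_g A) \<and>
     (nabla D (J_h D) \<mu>' \<noteq> 0 \<and>
      norm (nabla D (J_h D) \<mu>' - nabla D (J_r D M) \<mu>') / norm (nabla D (J_h D) \<mu>')
        \<le> min (tau_grad A) (beta3 A * \<delta>'))"

definition rho :: "('v, 'p::finite) problem \<Rightarrow> 'v rb \<Rightarrow> real^'p \<Rightarrow> real^'p \<Rightarrow> real" where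
  "rho D M \<mu> \<mu>' = (J_h D \<mu> - J_h D \<mu>') / (J_r D M \<mu> - J_r D M \<mu>')"

text \<open>
  Step 3 for the iterate \<open>\<mu>\<close>, AGC point \<open>c\<close> and trial point \<open>t\<close>, with current model \<open>M\<close> and radius
  \<open>\<delta>\<close>. The results are the next radius \<open>\<delta>'\<close> and model \<open>M'\<close>. If \<open>g_h D t \<le> tau_FOC A\<close> in case (i) or
  (iii), the algorithm stops and neither relation holds. The flag \<open>sp\<close> is the skip flag of the
  previous iteration.
\<close>

definition case_i :: "('v::real_inner, 'p::finite) problem \<Rightarrow> 'v rb \<Rightarrow> real^'p \<Rightarrow> real^'p \<Rightarrow> bool" where
  "case_i D M c t \<longleftrightarrow> J_r D M t + Delta_J D M t < J_r D M c"

definition case_ii :: "('v::real_inner, 'p::finite) problem \<Rightarrow> 'v rb \<Rightarrow> real^'p \<Rightarrow> real^'p \<Rightarrow> bool" where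
  "case_ii D M c t \<longleftrightarrow> \<not> case_i D M c t \<and> J_r D M t - Delta_J D M t > J_r D M c"

definition case_iii :: "('v::real_inner, 'p::finite) problem \<Rightarrow> 'v rb \<Rightarrow> real^'p \<Rightarrow> real^'p \<Rightarrow> bool" where
  "case_iii D M c t \<longleftrightarrow> \<not> case_i D M c t \<and> \<not> case_ii D M c t"

inductive accept ::
  "('v::real_inner, 'p::finite) problem \<Rightarrow> 'p alg_par \<Rightarrow> 'v rb \<Rightarrow> real
     \<Rightarrow> real^'p \<Rightarrow> real^'p \<Rightarrow> real^'p \<Rightarrow> real \<Rightarrow> 'v rb \<Rightarrow> bool"
  for D A M \<delta> \<mu> c t where
  i: "case_i D M c t \<Longrightarrow> g_h D t > tau_FOC A \<Longrightarrow>
      \<delta>' = (if rho D M \<mu> t \<ge> eta_rho A then \<delta> / beta1 A else \<delta>) \<Longrightarrow>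
      M' = (if Skip D A M t \<delta>' then M else rb_update D (taylor A) M t) \<Longrightarrow>
      accept D A M \<delta> \<mu> c t \<delta>' M'"
| iii_skip: "case_iii D M c t \<Longrightarrow> g_h D t > tau_FOC A \<Longrightarrow>
      Skip D A M t (\<delta> / beta1 A) \<Longrightarrow> rho D M \<mu> t \<ge> eta_rho A \<Longrightarrow>
      accept D A M \<delta> \<mu> c t (\<delta> / beta1 A) M"
| iii_update: "case_iii D M c t \<Longrightarrow> g_h D t > tau_FOC A \<Longrightarrow>
      \<not> (Skip D A M t (\<delta> / beta1 A) \<and> rho D M \<mu> t \<ge> eta_rho A) \<Longrightarrow>
      J_h D t \<le> J_r D M c \<Longrightarrow>
      \<delta>' = (if rho D M \<mu> t < eta_rho A then \<delta> else \<delta> / beta1 A) \<Longrightarrow>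
      accept D A M \<delta> \<mu> c t \<delta>' (rb_update D (taylor A) M t)"

inductive reject ::
  "('v::real_inner, 'p::finite) problem \<Rightarrow> 'p alg_par \<Rightarrow> 'v rb \<Rightarrow> real \<Rightarrow> bool
     \<Rightarrow> real^'p \<Rightarrow> real^'p \<Rightarrow> real^'p \<Rightarrow> real \<Rightarrow> 'v rb \<Rightarrow> bool"
  for D A M \<delta> sp \<mu> c t where
  ii: "case_ii D M c t \<Longrightarrow>
      M' = (if beta1 A * \<delta> \<le> delta_min A \<or> sp then rb_update D (taylor A) M t else M) \<Longrightarrow>
      reject D A M \<delta> sp \<mu> c t (beta1 A * \<delta>) M'"
| iii: "case_iii D M c t \<Longrightarrow> g_h D t > tau_FOC A \<Longrightarrow>
      \<not> (Skip D A M t (\<delta> / beta1 A) \<and> rho D M \<mu> t \<ge> eta_rho A) \<Longrightarrow>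
      \<not> J_h D t \<le> J_r D M c \<Longrightarrow>
      M' = (if beta1 A * \<delta> \<le> delta_min A \<or> sp then rb_update D (taylor A) M t else M) \<Longrightarrow>
      reject D A M \<delta> sp \<mu> c t (beta1 A * \<delta>) M'"

text \<open>
  An infinite run. Iteration \<open>k\<close> starts at the iterate \<open>mu k\<close>, computes the AGC point \<open>agc k\<close> once,
  and then passes through the attempts \<open>0, ..., nrej k\<close>: all but the last trial points are rejected
  and the last one becomes \<open>mu (Suc k)\<close>. Since a rejection may change the radius and the model
  without advancing \<open>k\<close>, the radius \<open>rad k i\<close>, the model \<open>rb k i\<close> and the trial point \<open>trial k i\<close> are
  indexed by the attempt \<open>i\<close> as well. There is no skip flag before the first iteration; the model
  has just been built at \<open>mu 0\<close>, and the flag counts as false.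
\<close>

definition skip_prev ::
  "('v::real_inner, 'p::finite) problem \<Rightarrow> 'p alg_par \<Rightarrow> (nat \<Rightarrow> real^'p) \<Rightarrow> (nat \<Rightarrow> nat)
     \<Rightarrow> (nat \<Rightarrow> nat \<Rightarrow> real) \<Rightarrow> (nat \<Rightarrow> nat \<Rightarrow> 'v rb) \<Rightarrow> nat \<Rightarrow> bool" where
  "skip_prev D A mu nrej rad rb k =
     (case k of 0 \<Rightarrow> False
      | Suc m \<Rightarrow> Skip D A (rb m (nrej m)) (mu (Suc m)) (rad (Suc m) 0))"

definition trrb_run ::
  "('v::real_inner, 'p::finite) problem \<Rightarrow> 'p alg_par \<Rightarrow> (nat \<Rightarrow> real^'p) \<Rightarrow> (nat \<Rightarrow> real^'p)
     \<Rightarrow> (nat \<Rightarrow> nat) \<Rightarrow> (nat \<Rightarrow> nat \<Rightarrow> real) \<Rightarrow> (nat \<Rightarrow> nat \<Rightarrow> 'v rb) \<Rightarrow> (nat \<Rightarrow> nat \<Rightarrow> real^'p)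
     \<Rightarrow> bool" where
  "trrb_run D A mu agc nrej rad rb trial \<longleftrightarrow>
     mu 0 = mu_init A \<and> rad 0 0 = delta_init A \<and> rb 0 0 = rb_init D (mu_init A) \<and>
     (\<forall>k. is_AGC D A (rb k 0) (rad k 0) (mu k) (agc k) \<and>
          (\<forall>i\<le>nrej k. proj_newton D A (rb k i) (rad k i) (agc k) (trial k i)) \<and>
          (\<forall>i<nrej k. reject D A (rb k i) (rad k i) (skip_prev D A mu nrej rad rb k)
                        (mu k) (agc k) (trial k i) (rad k (Suc i)) (rb k (Suc i))) \<and>
          accept D A (rb k (nrej k)) (rad k (nrej k)) (mu k) (agc k) (trial k (nrej k))
                 (rad (Suc k) 0) (rb (Suc k) 0) \<and>
          mu (Suc k) = trial k (nrej k))"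

end

theory Submission
  imports Defs
begin

text \<open>
  The reduced spaces only grow inside the finite-dimensional \<open>Vh D\<close>, so the model is eventually
  constant. From then on the (Arm) decrease at the AGC points and (A5) make one fixed functional
  decrease along the iterates, and the AGC step lengths tend to \<open>0\<close>. After an update the error
  bound vanishes at the iterate, and after a skip it is at most \<open>beta3 A\<close> times the radius; with (A6)
  and (A7) the backtracking exponents are therefore bounded, so that \<open>g_r\<close> tends to \<open>0\<close>. Finally
  \<open>g_h\<close> equals \<open>g_r\<close> at an iterate whose truth states belong to the model, because the
  corrected functional is stationary in the states there, and a skip gives
  \<open>g_h \<le> (1 + tau_g A) g_r\<close>. Continuity of \<open>g_h\<close> concludes.
\<close>

section \<open>Galerkin problems on finite-dimensional subspaces\<close>

text \<open>(A6) gives smoothness and Lipschitz gradients only for models met in the run, whereas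
  the conclusion concerns \<open>J_h\<close>, whose pair of spaces \<open>(Vh D, Vh D)\<close> need
  not occur there. So \<open>J_h\<close> is written as a reduced functional itself, and its gradient
  is computed from difference quotients along the axes, one-sided at the boundary of the box. The
  ambient space may be infinite-dimensional and separability controls the forms only at fixed
  arguments. All states, however, stay in \<open>Vh D\<close>, where orthonormal coordinates turn
  convergence at fixed arguments into joint convergence.

  (A5) compares the values of two successive models, so it yields monotone decrease of a single
  function only once the model is frozen. Its lower bound \<open>tau_mac\<close> on the radii makes
  the gap between \<open>beta3 A\<close> times the radius and the radius itself at least
  \<open>(1 - beta3 A) * tau_mac\<close>. Uniform continuity converts this gap into a ball, of size
  independent of the iteration, on which the trust-region condition holds.\<close>

definition fin_dim :: "'v::real_vector set \<Rightarrow> bool" where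
  "fin_dim W \<longleftrightarrow> (\<exists>B. finite B \<and> span B = W)"

lemma fin_dim_subspace: "fin_dim W \<Longrightarrow> subspace W"
  unfolding fin_dim_def by auto

lemma fin_dim_basis:
  assumes "fin_dim V" "subspace W" "W \<subseteq> V"
  obtains B where "finite B" "independent B" "B \<subseteq> W" "span B = W"
proof -
  obtain B0 where B0: "finite B0" "span B0 = V"
    using assms(1) unfolding fin_dim_def by auto
  obtain B where B: "B \<subseteq> W" "independent B" "W \<subseteq> span B"
    using maximal_independent_subset by blast
  have "finite B"
    using independent_span_bound[OF B0(1) B(2)] B(1) B0(2) assms(3) by auto
  moreover have "span B = W"
    using B(1,3) assms(2) by (simp add: span_minimal subset_antisym)
  ultimately show ?thesis using that B by blast
qed

lemma fin_dim_subset: "fin_dim V \<Longrightarrow> subspace W \<Longrightarrow> W \<subseteq> V \<Longrightarrow> fin_dim W"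
  by (erule (2) fin_dim_basis) (auto simp: fin_dim_def)

text \<open>The union of the chain is itself a subspace of \<open>V\<close>, so it has a finite
  basis. Each basis vector already occurs in some member, and a member late enough to contain all of
  them is the whole union.\<close>

lemma fin_dim_chain_stabilises:
  assumes V: "fin_dim V" and W: "\<And>k::nat. subspace (W k)" "\<And>k. W k \<subseteq> V" "\<And>k. W k \<subseteq> W (Suc k)"
  obtains K where "\<And>k. K \<le> k \<Longrightarrow> W k = W K"
proof -
  have mono: "W m \<subseteq> W n" if "m \<le> n" for m n
    using lift_Suc_mono_le[of W, OF W(3) that] .
  have "subspace (\<Union>k. W k)"
    unfolding subspace_def
  proof (intro conjI ballI allI)
    show "0 \<in> (\<Union>k. W k)" using subspace_0[OF W(1)] by auto
    fix x y assume "x \<in> (\<Union>k. W k)" "y \<in> (\<Union>k. W k)"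
    then obtain m n where "x \<in> W m" "y \<in> W n" by auto
    then have "x \<in> W (max m n)" "y \<in> W (max m n)"
      using mono[of m "max m n"] mono[of n "max m n"] by auto
    then have "x + y \<in> W (max m n)" using W(1) by (intro subspace_add)
    then show "x + y \<in> (\<Union>k. W k)" by blast
  next
    fix c :: real and x assume "x \<in> (\<Union>k. W k)"
    then show "c *\<^sub>R x \<in> (\<Union>k. W k)" using subspace_scale[OF W(1)] by auto
  qed
  moreover have "(\<Union>k. W k) \<subseteq> V" using W(2) by auto
  ultimately obtain B where B: "finite B" "B \<subseteq> (\<Union>k. W k)" "span B = (\<Union>k. W k)"
    by (rule fin_dim_basis[OF V])
  then have "\<forall>b\<in>B. \<exists>n. b \<in> W n" by auto
  then obtain n where n: "\<And>b. b \<in> B \<Longrightarrow> b \<in> W (n b)" by metis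
  \<comment> \<open>The sum serves as an upper bound of all the indices \<open>n b\<close>, and
    makes sense for empty \<open>B\<close> as well.\<close>
  define K where "K = (\<Sum>b\<in>B. n b)"
  have "B \<subseteq> W K"
  proof
    fix b assume "b \<in> B"
    then have "n b \<le> K" unfolding K_def using B(1) by (simp add: member_le_sum)
    then show "b \<in> W K" using n[OF \<open>b \<in> B\<close>] mono by blast
  qed
  then have "(\<Union>k. W k) \<subseteq> W K" using B(3) W(1)[of K] by (metis span_minimal)
  then have "W k = W K" if "K \<le> k" for k
    using mono[OF that] by auto
  then show ?thesis using that by metis
qed

text \<open>Gram-Schmidt, one vector at a time: the component of \<open>b\<close> orthogonal to the
  span so far is normalised and added, or dropped if it vanishes.\<close>

lemma orthonormal_spanning:
  fixes B :: "'v::real_inner set"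
  assumes "finite B"
  shows "\<exists>C. finite C \<and> span C = span B \<and> (\<forall>c\<in>C. norm c = 1) \<and> (\<forall>c\<in>C. \<forall>d\<in>C. c \<noteq> d \<longrightarrow> c \<bullet> d = 0)"
  using assms
proof (induction B)
  case empty
  show ?case by (intro exI[of _ "{}"]) auto
next
  case (insert b B)
  then obtain C where C: "finite C" "span C = span B" "\<forall>c\<in>C. norm c = 1"
      "\<forall>c\<in>C. \<forall>d\<in>C. c \<noteq> d \<longrightarrow> c \<bullet> d = 0"
    by (elim exE conjE) (rule that)
  define r where "r = b - (\<Sum>c\<in>C. (b \<bullet> c) *\<^sub>R c)"
  have s: "(\<Sum>c\<in>C. (b \<bullet> c) *\<^sub>R c) \<in> span C"
    by (intro span_sum span_scale span_base)
  have orth: "r \<bullet> d = 0" if "d \<in> C" for d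
  proof -
    have "(\<Sum>c\<in>C. (b \<bullet> c) * (c \<bullet> d)) = (\<Sum>c\<in>C. if c = d then b \<bullet> d else 0)"
    proof (rule sum.cong[OF refl])
      fix c assume "c \<in> C"
      then show "(b \<bullet> c) * (c \<bullet> d) = (if c = d then b \<bullet> d else 0)"
        using C(3,4) that by (auto simp: norm_eq_1)
    qed
    also have "\<dots> = b \<bullet> d" using C(1) that by simp
    finally show ?thesis unfolding r_def by (simp add: inner_diff_left inner_sum_left)
  qed
  have insert_r: "span (insert b B) = span (insert r C)"
  proof -
    have "span (insert b B) = span (insert b C)"
      using C(2) by (simp add: span_insert)
    also have "\<dots> = span (insert r C)"
    proof (rule span_eq[THEN iffD2], intro conjI)
      have "r + (\<Sum>c\<in>C. (b \<bullet> c) *\<^sub>R c) \<in> span (insert r C)"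
        using s by (intro span_add) (auto intro: span_base span_mono[THEN subsetD, rotated])
      then show "insert b C \<subseteq> span (insert r C)"
        unfolding r_def by (auto intro: span_base)
      have "b - (\<Sum>c\<in>C. (b \<bullet> c) *\<^sub>R c) \<in> span (insert b C)"
        using s by (intro span_diff) (auto intro: span_base span_mono[THEN subsetD, rotated])
      then show "insert r C \<subseteq> span (insert b C)"
        unfolding r_def by (auto intro: span_base)
    qed
    finally show ?thesis .
  qed
  show ?case
  proof (cases "r = 0")
    case True
    then have "span (insert b B) = span C" using insert_r by (simp add: span_insert_0)
    then show ?thesis using C by (intro exI[of _ C]) auto
  next
    case False
    let ?e = "(1 / norm r) *\<^sub>R r"
    have "span (insert r C) = span (insert ?e C)"
    proof (rule span_eq[THEN iffD2], intro conjI)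
      have "norm r *\<^sub>R ?e \<in> span (insert ?e C)" by (intro span_scale span_base) simp
      then show "insert r C \<subseteq> span (insert ?e C)" using False by (auto intro: span_base)
      have "?e \<in> span (insert r C)" by (intro span_scale span_base) simp
      then show "insert ?e C \<subseteq> span (insert r C)" by (auto intro: span_base)
    qed
    moreover have "norm ?e = 1" using False by simp
    moreover have "?e \<bullet> d = 0" "d \<bullet> ?e = 0" if "d \<in> C" for d
      using orth[OF that] by (simp_all add: inner_commute)
    ultimately show ?thesis using C insert_r by (intro exI[of _ "insert ?e C"]) auto
  qed
qed

text \<open>The difference between \<open>x\<close> and its orthogonal projection lies in the span
  of \<open>C\<close> and is orthogonal to it, hence vanishes. The coordinates
  \<open>x \<bullet> c\<close> are continuous in \<open>x\<close>, and a linear functional on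
  \<open>W\<close> is determined by its values on the finite set \<open>C\<close>; the limit
  arguments below rest on these two facts.\<close>

lemma fin_dim_coordinates:
  fixes W :: "'v::real_inner set"
  assumes "fin_dim W"
  obtains C where "finite C" "C \<subseteq> W" "\<forall>x\<in>W. (\<Sum>c\<in>C. (x \<bullet> c) *\<^sub>R c) = x"
proof -
  obtain B where B: "finite B" "span B = W" using assms unfolding fin_dim_def by auto
  obtain C where C: "finite C" "span C = span B" "\<forall>c\<in>C. norm c = 1"
      "\<forall>c\<in>C. \<forall>d\<in>C. c \<noteq> d \<longrightarrow> c \<bullet> d = 0"
    using orthonormal_spanning[OF B(1)] by (elim exE conjE) (rule that)
  have "(\<Sum>c\<in>C. (x \<bullet> c) *\<^sub>R c) = x" if "x \<in> span C" for x
  proof -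
    let ?r = "x - (\<Sum>c\<in>C. (x \<bullet> c) *\<^sub>R c)"
    have "?r \<bullet> d = 0" if "d \<in> C" for d
    proof -
      have "(\<Sum>c\<in>C. (x \<bullet> c) * (c \<bullet> d)) = (\<Sum>c\<in>C. if c = d then x \<bullet> d else 0)"
      proof (rule sum.cong[OF refl])
        fix c assume "c \<in> C"
        then show "(x \<bullet> c) * (c \<bullet> d) = (if c = d then x \<bullet> d else 0)"
          using C(3,4) that by (auto simp: norm_eq_1)
      qed
      also have "\<dots> = x \<bullet> d" using C(1) that by simp
      finally show ?thesis by (simp add: inner_diff_left inner_sum_left)
    qed
    moreover have "?r \<in> span C"
      using that by (intro span_diff span_sum span_scale) (auto intro: span_base)
    ultimately have "?r \<bullet> ?r = 0"
    proof -
      have "orthogonal ?r ?r"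
        by (rule orthogonal_to_span[OF \<open>?r \<in> span C\<close>])
           (use \<open>\<And>d. d \<in> C \<Longrightarrow> ?r \<bullet> d = 0\<close> in \<open>auto simp: orthogonal_def\<close>)
      then show ?thesis by (simp add: orthogonal_def)
    qed
    then show ?thesis by simp
  qed
  then have "\<forall>x\<in>W. (\<Sum>c\<in>C. (x \<bullet> c) *\<^sub>R c) = x" using C(2) B(2) by simp
  moreover have "C \<subseteq> W" using C(2) B(2) span_superset[of C] by simp
  ultimately show ?thesis using that C(1) by simp
qed

lemma linear_coordinates:
  fixes x :: "'v::real_inner"
  assumes "linear g" "(\<Sum>c\<in>C. (x \<bullet> c) *\<^sub>R c) = x"
  shows "(\<Sum>c\<in>C. (x \<bullet> c) *\<^sub>R g c) = g x"
proof -
  have "g x = g (\<Sum>c\<in>C. (x \<bullet> c) *\<^sub>R c)" using assms(2) by simp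
  also have "\<dots> = (\<Sum>c\<in>C. (x \<bullet> c) *\<^sub>R g c)"
    using assms(1) by (simp add: linear_sum linear_scale)
  finally show ?thesis by simp
qed

text \<open>Convergence of the functionals at each fixed vector suffices for a moving argument: in
  coordinates \<open>f s (x s)\<close> is a finite sum of products of two convergent factors, so no
  uniform bound on the functionals enters.\<close>

lemma tendsto_linear_fin_dim:
  fixes x0 :: "'v::real_inner" and f :: "'s \<Rightarrow> 'v \<Rightarrow> real"
  assumes W: "fin_dim W" and x0: "x0 \<in> W" and x: "eventually (\<lambda>s. x s \<in> W) F" "(x \<longlongrightarrow> x0) F"
    and f: "eventually (\<lambda>s. linear (f s)) F" "linear f0" "\<And>v. ((\<lambda>s. f s v) \<longlongrightarrow> f0 v) F"
  shows "((\<lambda>s. f s (x s)) \<longlongrightarrow> f0 x0) F"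
proof -
  obtain C where C: "finite C" "C \<subseteq> W" "\<forall>x\<in>W. (\<Sum>c\<in>C. (x \<bullet> c) *\<^sub>R c) = x"
    by (rule fin_dim_coordinates[OF W])
  have 1: "((\<lambda>s. \<Sum>c\<in>C. (x s \<bullet> c) *\<^sub>R f s c) \<longlongrightarrow> (\<Sum>c\<in>C. (x0 \<bullet> c) *\<^sub>R f0 c)) F"
    by (intro tendsto_sum tendsto_scaleR tendsto_inner x f tendsto_const)
  have 2: "(\<Sum>c\<in>C. (x0 \<bullet> c) *\<^sub>R f0 c) = f0 x0"
    by (rule linear_coordinates[OF f(2) C(3)[rule_format, OF x0]])
  have 3: "eventually (\<lambda>s. (\<Sum>c\<in>C. (x s \<bullet> c) *\<^sub>R f s c) = f s (x s)) F"
    using x(1) f(1) by eventually_elim (rule linear_coordinates[OF _ C(3)[rule_format]])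
  show ?thesis using Lim_transform_eventually[OF 1 3] 2 by simp
qed

section \<open>Bilinear forms with moving arguments, and Galerkin problems for them\<close>

lemma bilinear_lin:
  assumes "bilinear f"
  shows "linear (f x)" "linear (\<lambda>y. f y x)"
  using assms unfolding bilinear_def by auto

lemma bilinear_of_bounded:
  assumes "bounded_bilinear (f :: 'v::real_normed_vector \<Rightarrow> 'v \<Rightarrow> real)"
  shows "bilinear f"
  unfolding bilinear_def
  using bounded_bilinear.bounded_linear_left[OF assms] bounded_bilinear.bounded_linear_right[OF assms]
  by (simp add: bounded_linear.linear)

lemma bilinear_flip: "bilinear f \<Longrightarrow> bilinear (\<lambda>u v. f v u)"
  unfolding bilinear_def by auto

lemma coercive_flip: "coercive f \<Longrightarrow> coercive (\<lambda>u v. f v u)"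
  unfolding coercive_def .

lemma tendsto_bilinear_fin_dim:
  fixes x0 y0 :: "'v::real_inner" and f :: "'s \<Rightarrow> 'v \<Rightarrow> 'v \<Rightarrow> real"
  assumes W: "fin_dim W" and x0: "x0 \<in> W" "y0 \<in> W"
    and x: "eventually (\<lambda>s. x s \<in> W) F" "(x \<longlongrightarrow> x0) F"
    and y: "eventually (\<lambda>s. y s \<in> W) F" "(y \<longlongrightarrow> y0) F"
    and f: "eventually (\<lambda>s. bilinear (f s)) F" "bilinear f0" "\<And>u v. ((\<lambda>s. f s u v) \<longlongrightarrow> f0 u v) F"
  shows "((\<lambda>s. f s (x s) (y s)) \<longlongrightarrow> f0 x0 y0) F"
proof (rule tendsto_linear_fin_dim[OF W x0(2) y])
  show "eventually (\<lambda>s. linear (f s (x s))) F"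
    using f(1) by eventually_elim (rule bilinear_lin)
  show "linear (f0 x0)" using f(2) by (rule bilinear_lin)
  show "((\<lambda>s. f s (x s) v) \<longlongrightarrow> f0 x0 v) F" for v
  proof (rule tendsto_linear_fin_dim[OF W x0(1) x])
    show "eventually (\<lambda>s. linear (\<lambda>u. f s u v)) F"
      using f(1) by eventually_elim (rule bilinear_lin)
    show "linear (\<lambda>u. f0 u v)" using f(2) by (rule bilinear_lin)
  qed (rule f)
qed

text \<open>Lax-Milgram in finite dimension: positivity makes the operator representing
  \<open>a\<close> on \<open>W\<close> injective, and counting dimensions makes it surjective onto
  \<open>W\<close>.\<close>

lemma galerkin_exists:
  fixes W :: "'v::real_inner set" and a :: "'v \<Rightarrow> 'v \<Rightarrow> real"
  assumes W: "fin_dim W" and a: "bilinear a" and pos: "\<And>u. u \<noteq> 0 \<Longrightarrow> a u u > 0" and f: "linear f"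
  shows "\<exists>!u. u \<in> W \<and> (\<forall>v\<in>W. a u v = f v)"
proof (rule ex_ex1I)
  obtain C where C: "finite C" "C \<subseteq> W" "\<forall>x\<in>W. (\<Sum>c\<in>C. (x \<bullet> c) *\<^sub>R c) = x"
    by (rule fin_dim_coordinates[OF W])
  obtain B where B: "finite B" "independent B" "B \<subseteq> W" "span B = W"
    by (rule fin_dim_basis[OF W fin_dim_subspace[OF W] order_refl])
  \<comment> \<open>\<open>T u\<close> is the Riesz representative in \<open>W\<close> of the
    functional \<open>a u\<close> restricted to \<open>W\<close>.\<close>
  define T where "T u = (\<Sum>c\<in>C. a u c *\<^sub>R c)" for u
  have T_inner: "T u \<bullet> v = a u v" if "v \<in> W" for u v
    using linear_coordinates[OF bilinear_lin(1)[OF a] C(3)[rule_format, OF that], of u]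
    unfolding T_def by (simp add: inner_sum_left inner_commute[of v] mult.commute)
  have linT: "linear T"
    unfolding T_def using bilinear_lin(2)[OF a]
    by (intro linearI)
       (simp_all add: linear_add[OF bilinear_lin(2)[OF a]] linear_scale[OF bilinear_lin(2)[OF a]]
         scaleR_left_distrib sum.distrib scaleR_sum_right)
  have TW: "T u \<in> W" for u
    unfolding T_def using C(2) fin_dim_subspace[OF W] by (auto intro!: subspace_sum subspace_scale)
  have inj: "inj_on T (span B)"
  proof (rule inj_onI)
    fix x y assume xy: "x \<in> span B" "y \<in> span B" "T x = T y"
    have "a (x - y) (x - y) = T (x - y) \<bullet> (x - y)"
      using xy B(4) by (intro T_inner[symmetric]) (auto intro: span_diff)
    also have "\<dots> = 0" using xy(3) linT by (simp add: linear_diff)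
    finally show "x = y" using pos[of "x - y"] by force
  qed
  have ind: "independent (T ` B)"
    by (rule linear_independent_injective_image[OF linT B(2) inj])
  have card: "card (T ` B) = card B"
    using inj inj_on_subset span_superset by (metis card_image)
  \<comment> \<open>The image of the basis is independent and as large as \<open>B\<close>. A vector
    of \<open>W\<close> outside its span would give more independent vectors in
    \<open>span B\<close> than \<open>B\<close> has elements.\<close>
  have onto: "W \<subseteq> span (T ` B)"
  proof
    fix x assume x: "x \<in> W"
    show "x \<in> span (T ` B)"
    proof (rule ccontr)
      assume nx: "x \<notin> span (T ` B)"
      then have "independent (insert x (T ` B))" using ind by (simp add: independent_insert)
      moreover have "insert x (T ` B) \<subseteq> span B" using x TW B(4) by auto
      ultimately have "card (insert x (T ` B)) \<le> card B"
        using independent_span_bound[OF B(1)] by simp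
      moreover have "x \<notin> T ` B" using nx span_base[of x "T ` B"] by auto
      ultimately show False using card B(1) by simp
    qed
  qed
  define y where "y = (\<Sum>c\<in>C. f c *\<^sub>R c)"
  have y_inner: "y \<bullet> v = f v" if "v \<in> W" for v
    using linear_coordinates[OF f C(3)[rule_format, OF that]]
    unfolding y_def by (simp add: inner_sum_left inner_commute[of v] mult.commute)
  have "y \<in> W" unfolding y_def using C(2) fin_dim_subspace[OF W]
    by (auto intro!: subspace_sum subspace_scale)
  moreover have "span (T ` B) = T ` W" using linear_span_image[OF linT, of B] B(4) by simp
  ultimately obtain u where "u \<in> W" "y = T u" using onto by auto
  then show "\<exists>u. u \<in> W \<and> (\<forall>v\<in>W. a u v = f v)"
    using T_inner y_inner by (intro exI[of _ u]) auto
next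
  fix u w assume uw: "u \<in> W \<and> (\<forall>v\<in>W. a u v = f v)" "w \<in> W \<and> (\<forall>v\<in>W. a w v = f v)"
  then have "u - w \<in> W" using subspace_diff[OF fin_dim_subspace[OF W]] by simp
  then have "a (u - w) (u - w) = 0"
    using uw by (simp add: linear_diff[OF bilinear_lin(2)[OF a]])
  then show "u = w" using pos[of "u - w"] by force
qed

text \<open>
  The same statement yields continuity of Galerkin solutions and, applied to difference quotients,
  their differentiability.
\<close>

lemma galerkin_tendsto:
  fixes W :: "'v::real_inner set" and a :: "'s \<Rightarrow> 'v \<Rightarrow> 'v \<Rightarrow> real"
  assumes W: "fin_dim W"
    and a: "eventually (\<lambda>s. bilinear (a s)) F" "bilinear a_lim" "\<And>u v. ((\<lambda>s. a s u v) \<longlongrightarrow> a_lim u v) F"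
    and coer: "coercive a_lim"
    and f: "eventually (\<lambda>s. linear (f s)) F" "linear f_lim" "\<And>v. ((\<lambda>s. f s v) \<longlongrightarrow> f_lim v) F"
    and w: "eventually (\<lambda>s. w s \<in> W \<and> (\<forall>v\<in>W. a s (w s) v = f s v)) F"
    and w0: "w0 \<in> W" "\<And>v. v \<in> W \<Longrightarrow> a_lim w0 v = f_lim v"
  shows "(w \<longlongrightarrow> w0) F"
proof -
  obtain C where C: "finite C" "C \<subseteq> W" "\<forall>x\<in>W. (\<Sum>c\<in>C. (x \<bullet> c) *\<^sub>R c) = x"
    by (rule fin_dim_coordinates[OF W])
  obtain \<alpha> where \<alpha>: "\<alpha> > 0" "\<And>u. \<alpha> * (norm u)\<^sup>2 \<le> a_lim u u"
    using coer unfolding coercive_def by auto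
  have bound: "\<bar>g x\<bar> \<le> norm x * (\<Sum>c\<in>C. norm c * \<bar>g c\<bar>)" if "linear g" "x \<in> W"
    for g :: "'v \<Rightarrow> real" and x
  proof -
    have "\<bar>g x\<bar> = \<bar>\<Sum>c\<in>C. (x \<bullet> c) *\<^sub>R g c\<bar>" using linear_coordinates[OF that(1) C(3)[rule_format, OF that(2)]] by simp
    also have "\<dots> \<le> (\<Sum>c\<in>C. \<bar>(x \<bullet> c) *\<^sub>R g c\<bar>)" by (rule sum_abs)
    also have "\<dots> \<le> (\<Sum>c\<in>C. norm x * (norm c * \<bar>g c\<bar>))"
      by (intro sum_mono) (simp add: abs_mult mult.assoc[symmetric] mult_right_mono Cauchy_Schwarz_ineq2)
    finally show ?thesis by (simp add: sum_distrib_left)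
  qed
  \<comment> \<open>\<open>\<rho> s\<close> bounds the residual left by the limit \<open>w0\<close>
    in the problem with index \<open>s\<close>, and \<open>\<epsilon> s\<close> bounds the
    perturbation of the form; both are read off the coordinates on \<open>C\<close> and tend to
    zero.\<close>
  define \<rho> where "\<rho> s = (\<Sum>c\<in>C. norm c * \<bar>f s c - a s w0 c\<bar>)" for s
  define \<epsilon> where "\<epsilon> s = (\<Sum>c\<in>C. norm c * (\<Sum>d\<in>C. norm d * \<bar>a s d c - a_lim d c\<bar>))" for s
  have "(\<rho> \<longlongrightarrow> (\<Sum>c\<in>C. norm c * \<bar>f_lim c - a_lim w0 c\<bar>)) F"
    unfolding \<rho>_def by (intro tendsto_intros f a)
  moreover have "(\<Sum>c\<in>C. norm c * \<bar>f_lim c - a_lim w0 c\<bar>) = 0"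
    using w0(2) C(2) by (intro sum.neutral) auto
  ultimately have \<rho>0: "(\<rho> \<longlongrightarrow> 0) F" by simp
  have "(\<epsilon> \<longlongrightarrow> (\<Sum>c\<in>C. norm c * (\<Sum>d\<in>C. norm d * \<bar>a_lim d c - a_lim d c\<bar>))) F"
    unfolding \<epsilon>_def by (intro tendsto_intros a)
  then have "(\<epsilon> \<longlongrightarrow> 0) F" by simp
  \<comment> \<open>Only the limit form is assumed coercive. Once the perturbation is below half of
    \<open>\<alpha>\<close>, the form \<open>a s\<close> is coercive on \<open>W\<close> with
    constant \<open>\<alpha> / 2\<close>, which is the source of the factor
    \<open>2 / \<alpha>\<close> in the error bound.\<close>
  then have ev: "eventually (\<lambda>s. \<epsilon> s < \<alpha> / 2) F" using \<alpha>(1) by (intro order_tendstoD) auto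
  have "eventually (\<lambda>s. norm (w s - w0) \<le> 2 / \<alpha> * \<rho> s) F"
    using a(1) f(1) w ev
  proof eventually_elim
    case (elim s)
    let ?z = "w s - w0"
    have z: "?z \<in> W" using elim w0(1) fin_dim_subspace[OF W] by (auto intro: subspace_diff)
    have 1: "a s ?z ?z = f s ?z - a s w0 ?z"
      using elim z by (simp add: linear_diff[OF bilinear_lin(2)])
    have lin1: "linear (\<lambda>v. f s v - a s w0 v)"
      by (intro linear_compose_sub elim bilinear_lin)
    have 2: "\<bar>f s ?z - a s w0 ?z\<bar> \<le> norm ?z * \<rho> s"
      using bound[OF lin1 z] unfolding \<rho>_def .
    have "\<bar>a s ?z ?z - a_lim ?z ?z\<bar> \<le> norm ?z * (\<Sum>c\<in>C. norm c * \<bar>a s ?z c - a_lim ?z c\<bar>)"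
      by (rule bound[OF _ z]) (intro linear_compose_sub elim bilinear_lin a(2))
    also have "\<dots> \<le> norm ?z * (\<Sum>c\<in>C. norm c * (norm ?z * (\<Sum>d\<in>C. norm d * \<bar>a s d c - a_lim d c\<bar>)))"
      by (intro mult_left_mono sum_mono bound[OF _ z] norm_ge_zero linear_compose_sub bilinear_lin elim a(2))
    also have "\<dots> = norm ?z * (norm ?z * \<epsilon> s)"
      unfolding \<epsilon>_def by (simp add: sum_distrib_left mult.left_commute)
    finally have 3: "\<bar>a s ?z ?z - a_lim ?z ?z\<bar> \<le> norm ?z * (norm ?z * \<epsilon> s)" .
    have 4: "norm ?z * (norm ?z * \<epsilon> s) \<le> norm ?z * (norm ?z * (\<alpha> / 2))"
      using elim by (intro mult_left_mono) auto
    have "\<alpha> * (norm ?z)\<^sup>2 \<le> norm ?z * \<rho> s + norm ?z * (norm ?z * (\<alpha> / 2))"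
      using \<alpha>(2)[of ?z] 1 2 3 4 by linarith
    then have "norm ?z * (\<alpha> / 2 * norm ?z) \<le> norm ?z * \<rho> s"
      by (simp add: power2_eq_square algebra_simps)
    moreover have "\<rho> s \<ge> 0" unfolding \<rho>_def by (intro sum_nonneg) simp
    ultimately show ?case
      using \<alpha>(1) by (cases "norm ?z = 0") (auto simp: field_simps)
  qed
  moreover have "((\<lambda>s. 2 / \<alpha> * \<rho> s) \<longlongrightarrow> 0) F" using \<rho>0 by (rule tendsto_mult_right_zero)
  ultimately have "((\<lambda>s. w s - w0) \<longlongrightarrow> 0) F" by (rule Lim_null_comparison)
  then show ?thesis by (simp add: LIM_zero_iff)
qed

text \<open>The remainder in the definition of the derivative is scaled by the absolute value of
  \<open>t\<close>, the quotient by \<open>t\<close> itself; the two differ by a sign, which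
  disappears in the norm. The quotient form is the useful one, since quotients of Galerkin solutions
  again solve Galerkin problems.\<close>

lemma has_vector_derivative_iff_quotient:
  "(f has_vector_derivative d) (at (0::real) within T) \<longleftrightarrow>
     ((\<lambda>t. (1 / t) *\<^sub>R (f t - f 0)) \<longlongrightarrow> d) (at 0 within T)"
proof -
  have "((\<lambda>t. (f t - f 0 - t *\<^sub>R d) /\<^sub>R \<bar>t\<bar>) \<longlongrightarrow> 0) (at 0 within T) \<longleftrightarrow>
        ((\<lambda>t. (1 / t) *\<^sub>R (f t - f 0) - d) \<longlongrightarrow> 0) (at 0 within T)"
  proof -
    have "norm ((f t - f 0 - t *\<^sub>R d) /\<^sub>R \<bar>t\<bar>) = norm ((1 / t) *\<^sub>R (f t - f 0) - d)" if "t \<noteq> 0" for t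
    proof -
      have "(1 / t) *\<^sub>R (f t - f 0) - d = (1 / t) *\<^sub>R (f t - f 0 - t *\<^sub>R d)"
        using that by (simp add: algebra_simps)
      then show ?thesis by (simp add: divide_inverse)
    qed
    then have "eventually (\<lambda>t. norm ((f t - f 0 - t *\<^sub>R d) /\<^sub>R \<bar>t\<bar>) = norm ((1 / t) *\<^sub>R (f t - f 0) - d))
        (at 0 within T)"
      by (auto simp: eventually_at_filter)
    then show ?thesis
      by (subst (1 2) tendsto_norm_zero_iff[symmetric]) (rule tendsto_cong)
  qed
  then show ?thesis
    unfolding has_vector_derivative_def has_derivative_within
    by (simp add: LIM_zero_iff bounded_linear_scaleR_left divide_inverse diff_diff_eq)
qed

text \<open>Subtracting \<open>a t (w 0) v\<close> from the equation for \<open>w t\<close> and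
  dividing by \<open>t\<close> gives a Galerkin problem for the difference quotient, with the same
  form \<open>a t\<close>. Its data converge to those of the sensitivity equation,
  \<open>a 0 w' v = df v - da (w 0) v\<close>, so convergence of the quotient is an instance of
  \<open>galerkin_tendsto\<close>. The derivative stays in \<open>W\<close>.\<close>

lemma galerkin_has_vector_derivative:
  fixes W :: "'v::real_inner set" and a :: "real \<Rightarrow> 'v \<Rightarrow> 'v \<Rightarrow> real"
  assumes W: "fin_dim W" and T: "0 \<in> T"
    and a: "\<And>t. t \<in> T \<Longrightarrow> bilinear (a t)" and coer: "coercive (a 0)"
    and da: "bilinear da" "\<And>u v. ((\<lambda>t. a t u v) has_vector_derivative da u v) (at 0 within T)"
    and f: "\<And>t. t \<in> T \<Longrightarrow> linear (f t)"
    and df: "linear df" "\<And>v. ((\<lambda>t. f t v) has_vector_derivative df v) (at 0 within T)"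
    and w: "\<And>t. t \<in> T \<Longrightarrow> w t \<in> W" "\<And>t v. t \<in> T \<Longrightarrow> v \<in> W \<Longrightarrow> a t (w t) v = f t v"
  shows "\<exists>w'\<in>W. (w has_vector_derivative w') (at 0 within T)"
proof -
  have pos: "a 0 u u > 0" if "u \<noteq> 0" for u
  proof -
    obtain \<alpha> where "\<alpha> > 0" "\<alpha> * (norm u)\<^sup>2 \<le> a 0 u u" using coer unfolding coercive_def by blast
    moreover have "\<alpha> * (norm u)\<^sup>2 > 0" using that \<open>\<alpha> > 0\<close> by simp
    ultimately show ?thesis by linarith
  qed
  have lin: "linear (\<lambda>v. df v - da (w 0) v)"
    by (intro linear_compose_sub df bilinear_lin da)
  obtain w' where w': "w' \<in> W" "\<And>v. v \<in> W \<Longrightarrow> a 0 w' v = df v - da (w 0) v"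
    using galerkin_exists[OF W a[OF T] pos lin] by blast
  have evT: "eventually (\<lambda>t. t \<in> T) (at 0 within T)" by (simp add: eventually_at_filter)
  have evT0: "eventually (\<lambda>t. t \<in> T \<and> t \<noteq> 0) (at 0 within T)" by (simp add: eventually_at_filter)
  have "((\<lambda>t. (1 / t) *\<^sub>R (w t - w 0)) \<longlongrightarrow> w') (at 0 within T)"
  proof (rule galerkin_tendsto[OF W, where a = a and a_lim = "a 0" and
        f = "\<lambda>t v. (1 / t) *\<^sub>R (f t v - f 0 v) - (1 / t) *\<^sub>R (a t (w 0) v - a 0 (w 0) v)"
        and f_lim = "\<lambda>v. df v - da (w 0) v"])
    show "eventually (\<lambda>t. bilinear (a t)) (at 0 within T)" using evT by eventually_elim (rule a)
    show "((\<lambda>t. a t u v) \<longlongrightarrow> a 0 u v) (at 0 within T)" for u v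
      using has_vector_derivative_continuous[OF da(2), of u v] by (simp add: continuous_within)
    show "eventually (\<lambda>t. linear (\<lambda>v. (1 / t) *\<^sub>R (f t v - f 0 v) - (1 / t) *\<^sub>R (a t (w 0) v - a 0 (w 0) v)))
        (at 0 within T)"
      using evT
      by eventually_elim (intro linear_compose_sub linear_compose_scale_right bilinear_lin a f T; assumption)
    show "((\<lambda>t. (1 / t) *\<^sub>R (f t v - f 0 v) - (1 / t) *\<^sub>R (a t (w 0) v - a 0 (w 0) v))
        \<longlongrightarrow> df v - da (w 0) v) (at 0 within T)" for v
      by (intro tendsto_diff df(2)[unfolded has_vector_derivative_iff_quotient]
          da(2)[unfolded has_vector_derivative_iff_quotient])
    show "eventually (\<lambda>t. (1 / t) *\<^sub>R (w t - w 0) \<in> W \<and> (\<forall>v\<in>W. a t ((1 / t) *\<^sub>R (w t - w 0)) v =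
        (1 / t) *\<^sub>R (f t v - f 0 v) - (1 / t) *\<^sub>R (a t (w 0) v - a 0 (w 0) v))) (at 0 within T)"
      using evT0
    proof eventually_elim
      case (elim t)
      have "a t ((1 / t) *\<^sub>R (w t - w 0)) v = (1 / t) * (a t (w t) v - a t (w 0) v)" for v
        using bilinear_lin(2)[OF a, of t v] elim
        by (simp add: linear_diff[of "\<lambda>y. a t y v"] linear_scale[of "\<lambda>y. a t y v"])
      then show ?case
        using elim w w[OF T] T fin_dim_subspace[OF W]
        by (auto intro!: subspace_scale subspace_diff simp: algebra_simps)
    qed
  qed (use a[OF T] coer lin w' in auto)
  then show ?thesis using w'(1) has_vector_derivative_iff_quotient by blast
qed

section \<open>Calculus on a box\<close>

abbreviation axis_seg :: "real^'p \<Rightarrow> real^'p \<Rightarrow> 'p::finite \<Rightarrow> real^'p \<Rightarrow> real set" where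
  "axis_seg lo hi i \<mu> \<equiv> {t. \<mu> + t *\<^sub>R axis i 1 \<in> cbox lo hi}"

lemma mem_axis_seg:
  fixes \<mu> :: "real^'p::finite"
  assumes "\<mu> \<in> cbox lo hi"
  shows "t \<in> axis_seg lo hi i \<mu> \<longleftrightarrow> lo $ i \<le> \<mu> $ i + t \<and> \<mu> $ i + t \<le> hi $ i"
  using assms by (auto simp: mem_box_cart axis_def)

text \<open>The segment is a nondegenerate interval containing \<open>0\<close>, possibly as an
  endpoint. This makes derivatives within it unique, so that \<open>pdiff\<close> can be
  evaluated.\<close>

lemma at_axis_seg_neq_bot:
  fixes \<mu> :: "real^'p::finite"
  assumes "\<mu> \<in> cbox lo hi" "lo $ i \<noteq> hi $ i"
  shows "at 0 within axis_seg lo hi i \<mu> \<noteq> bot"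
proof -
  have seg: "axis_seg lo hi i \<mu> = {lo $ i - \<mu> $ i .. hi $ i - \<mu> $ i}"
    by (rule set_eqI) (simp only: mem_axis_seg[OF assms(1)] atLeastAtMost_iff, linarith)
  have *: "lo $ i \<le> \<mu> $ i" "\<mu> $ i \<le> hi $ i" using assms(1) by (auto simp: mem_box_cart)
  then have "0 islimpt {lo $ i - \<mu> $ i .. hi $ i - \<mu> $ i}"
    using assms(2) by (subst islimpt_Icc) auto
  then show ?thesis unfolding seg by (simp add: trivial_limit_within)
qed

lemma pdiff_eqI:
  fixes \<mu> :: "real^'p::finite"
  assumes "\<mu> \<in> cbox lo hi" "lo $ i \<noteq> hi $ i"
    and "((\<lambda>t. f (\<mu> + t *\<^sub>R axis i 1)) has_vector_derivative d) (at 0 within axis_seg lo hi i \<mu>)"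
  shows "pdiff lo hi f i \<mu> = d"
  unfolding pdiff_def using assms(2) vector_derivative_within[OF at_axis_seg_neq_bot[OF assms(1,2)] assms(3)]
  by simp

text \<open>Continuous differentiability expressed by partial derivatives alone, the form in which
  difference quotients along the axes use it. In a degenerate direction \<open>pdiff\<close> is
  constantly \<open>0\<close>, so nothing but the continuity of that constant is asked
  there.\<close>

definition box_C1 :: "real^'p \<Rightarrow> real^'p::finite \<Rightarrow> (real^'p \<Rightarrow> real) \<Rightarrow> bool" where
  "box_C1 lo hi f \<longleftrightarrow> continuous_on (cbox lo hi) f \<and>
     (\<forall>i. continuous_on (cbox lo hi) (pdiff lo hi f i)) \<and>
     (\<forall>i. lo $ i \<noteq> hi $ i \<longrightarrow> (\<forall>\<mu>\<in>cbox lo hi.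
        ((\<lambda>t. f (\<mu> + t *\<^sub>R axis i 1)) has_vector_derivative pdiff lo hi f i \<mu>)
          (at 0 within axis_seg lo hi i \<mu>)))"

lemma pdiff_degenerate: "lo $ i = hi $ i \<Longrightarrow> pdiff lo hi f i = (\<lambda>_. 0)"
  by (simp add: pdiff_def fun_eq_iff)

lemma axis_seg_has_vector_derivative:
  fixes \<mu> :: "real^'p::finite"
  assumes "(f has_derivative f') (at \<mu> within cbox lo hi)"
  shows "((\<lambda>t. f (\<mu> + t *\<^sub>R axis i 1)) has_vector_derivative f' (axis i 1)) (at 0 within axis_seg lo hi i \<mu>)"
proof -
  have "(f has_derivative f') (at (\<mu> + 0 *\<^sub>R axis i 1) within (\<lambda>t. \<mu> + t *\<^sub>R axis i 1) ` axis_seg lo hi i \<mu>)"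
    using assms by (simp) (rule has_derivative_subset, auto)
  moreover have "((\<lambda>t. \<mu> + t *\<^sub>R axis i 1) has_derivative (\<lambda>t. t *\<^sub>R axis i 1)) (at 0 within axis_seg lo hi i \<mu>)"
    by (auto intro!: derivative_eq_intros)
  ultimately have "((\<lambda>t. f (\<mu> + t *\<^sub>R axis i 1)) has_derivative (\<lambda>t. f' (t *\<^sub>R axis i 1))) (at 0 within axis_seg lo hi i \<mu>)"
    by (rule has_derivative_in_compose[rotated])
  moreover have "f' (t *\<^sub>R axis i 1) = t *\<^sub>R f' (axis i 1)" for t
    using has_derivative_linear[OF assms] by (rule linear_scale)
  ultimately show ?thesis by (simp add: has_vector_derivative_def)
qed

lemma pdiff_eq_has_derivative:
  fixes \<mu> :: "real^'p::finite"
  assumes "(f has_derivative f') (at \<mu> within cbox lo hi)" "\<mu> \<in> cbox lo hi" "lo $ i \<noteq> hi $ i"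
  shows "pdiff lo hi f i \<mu> = f' (axis i 1)"
  by (rule pdiff_eqI[OF assms(2,3) axis_seg_has_vector_derivative[OF assms(1)]])

lemma C2_loclip_imp_box_C1:
  fixes lo hi :: "real^'p::finite"
  assumes "C2_loclip_on (cbox lo hi) f"
  shows "box_C1 lo hi f"
proof -
  obtain f' :: "real^'p \<Rightarrow> (real^'p) \<Rightarrow>\<^sub>L real" and f'' where f':
      "\<And>x. x \<in> cbox lo hi \<Longrightarrow> (f has_derivative blinfun_apply (f' x)) (at x within cbox lo hi)"
      "\<And>x. x \<in> cbox lo hi \<Longrightarrow> (f' has_derivative blinfun_apply (f'' x)) (at x within cbox lo hi)"
    using assms unfolding C2_loclip_on_def by auto
  have contf: "continuous_on (cbox lo hi) f" and contf': "continuous_on (cbox lo hi) f'"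
    using f' by (auto intro!: has_derivative_continuous_on)
  have "continuous_on (cbox lo hi) (pdiff lo hi f i)" for i
  proof (cases "lo $ i = hi $ i")
    case False
    have "continuous_on (cbox lo hi) (\<lambda>x. f' x (axis i 1))"
      by (intro continuous_intros contf')
    then show ?thesis
      using pdiff_eq_has_derivative[OF f'(1) _ False] by (simp cong: continuous_on_cong)
  qed (simp add: pdiff_degenerate)
  moreover have "((\<lambda>t. f (\<mu> + t *\<^sub>R axis i 1)) has_vector_derivative pdiff lo hi f i \<mu>)
          (at 0 within axis_seg lo hi i \<mu>)" if "\<mu> \<in> cbox lo hi" "lo $ i \<noteq> hi $ i" for i \<mu>
    using axis_seg_has_vector_derivative[OF f'(1)[OF that(1)], of i]
      pdiff_eq_has_derivative[OF f'(1)[OF that(1)] that] by simp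
  ultimately show ?thesis using contf unfolding box_C1_def by blast
qed

lemma box_C1_D:
  assumes "box_C1 lo hi f"
  shows "continuous_on (cbox lo hi) f" "continuous_on (cbox lo hi) (pdiff lo hi f i)"
    "\<mu> \<in> cbox lo hi \<Longrightarrow> lo $ i \<noteq> hi $ i \<Longrightarrow>
      ((\<lambda>t. f (\<mu> + t *\<^sub>R axis i 1)) has_vector_derivative pdiff lo hi f i \<mu>)
          (at 0 within axis_seg lo hi i \<mu>)"
  using assms unfolding box_C1_def by blast+

lemma has_vector_derivative_axis_seg_cong:
  fixes \<mu> :: "real^'p::finite"
  assumes "\<And>\<nu>. \<nu> \<in> cbox lo hi \<Longrightarrow> f \<nu> = g \<nu>" "\<mu> \<in> cbox lo hi"
  shows "((\<lambda>t. f (\<mu> + t *\<^sub>R axis i 1)) has_vector_derivative d) (at 0 within axis_seg lo hi i \<mu>) \<longleftrightarrow>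
    ((\<lambda>t. g (\<mu> + t *\<^sub>R axis i 1)) has_vector_derivative d) (at 0 within axis_seg lo hi i \<mu>)"
proof
  assume "((\<lambda>t. f (\<mu> + t *\<^sub>R axis i 1)) has_vector_derivative d) (at 0 within axis_seg lo hi i \<mu>)"
  then show "((\<lambda>t. g (\<mu> + t *\<^sub>R axis i 1)) has_vector_derivative d) (at 0 within axis_seg lo hi i \<mu>)"
    by (rule has_vector_derivative_transform[rotated 2]) (use assms in auto)
next
  assume "((\<lambda>t. g (\<mu> + t *\<^sub>R axis i 1)) has_vector_derivative d) (at 0 within axis_seg lo hi i \<mu>)"
  then show "((\<lambda>t. f (\<mu> + t *\<^sub>R axis i 1)) has_vector_derivative d) (at 0 within axis_seg lo hi i \<mu>)"
    by (rule has_vector_derivative_transform[rotated 2]) (use assms in auto)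
qed

lemma box_C1_lincomb:
  fixes lo hi :: "real^'p::finite"
  assumes \<theta>: "\<forall>q<(Q::nat). box_C1 lo hi (\<theta> q)"
    and f: "\<forall>\<mu>\<in>cbox lo hi. f \<mu> = (\<Sum>q<Q. \<theta> q \<mu> * b q)"
  shows "box_C1 lo hi f"
    and "\<mu> \<in> cbox lo hi \<Longrightarrow> pdiff lo hi f i \<mu> = (\<Sum>q<Q. pdiff lo hi (\<theta> q) i \<mu> * b q)"
proof -
  have deriv: "((\<lambda>t. f (\<mu> + t *\<^sub>R axis i 1)) has_vector_derivative
      (\<Sum>q<Q. pdiff lo hi (\<theta> q) i \<mu> * b q)) (at 0 within axis_seg lo hi i \<mu>)"
    if "\<mu> \<in> cbox lo hi" "lo $ i \<noteq> hi $ i" for \<mu> i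
  proof (subst has_vector_derivative_axis_seg_cong[where g = "\<lambda>\<nu>. \<Sum>q<Q. \<theta> q \<nu> * b q"])
    show "((\<lambda>t. \<Sum>q<Q. \<theta> q (\<mu> + t *\<^sub>R axis i 1) * b q) has_vector_derivative
      (\<Sum>q<Q. pdiff lo hi (\<theta> q) i \<mu> * b q)) (at 0 within axis_seg lo hi i \<mu>)"
      using \<theta> that
      by (intro has_vector_derivative_sum has_vector_derivative_mult_left box_C1_D(3)) auto
  qed (use f that in auto)
  have eq: "pdiff lo hi f i \<mu> = (\<Sum>q<Q. pdiff lo hi (\<theta> q) i \<mu> * b q)" if "\<mu> \<in> cbox lo hi" for \<mu> i
  proof (cases "lo $ i = hi $ i")
    case False
    then show ?thesis by (intro pdiff_eqI[OF that _ deriv] that)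
  qed (simp add: pdiff_degenerate)
  then show "\<mu> \<in> cbox lo hi \<Longrightarrow> pdiff lo hi f i \<mu> = (\<Sum>q<Q. pdiff lo hi (\<theta> q) i \<mu> * b q)" .
  have "continuous_on (cbox lo hi) (\<lambda>\<mu>. \<Sum>q<Q. \<theta> q \<mu> * b q)"
    "continuous_on (cbox lo hi) (\<lambda>\<mu>. \<Sum>q<Q. pdiff lo hi (\<theta> q) i \<mu> * b q)" for i
    using \<theta> by (intro continuous_on_sum continuous_on_mult_right box_C1_D(1) box_C1_D(2); simp)+
  then show "box_C1 lo hi f"
    unfolding box_C1_def using deriv eq f by (simp cong: continuous_on_cong)
qed

text \<open>Differentiating acts on the coefficient functions only. The partial derivative is
  therefore a combination of the same non-parametric forms, which is why it is again
  bilinear.\<close>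

lemma separable_bilinear_box_C1:
  fixes lo hi :: "real^'p::finite"
  assumes "separable_bilinear (cbox lo hi) f"
  shows "box_C1 lo hi (\<lambda>\<mu>. f \<mu> u v)"
    and "\<mu> \<in> cbox lo hi \<Longrightarrow> bilinear (\<lambda>u v. pdiff lo hi (\<lambda>\<mu>. f \<mu> u v) i \<mu>)"
proof -
  obtain Q :: nat and \<theta> b where Q: "\<forall>i<Q. bilinear (b i) \<and> C2_loclip_on (cbox lo hi) (\<theta> i)"
      "\<forall>\<mu>\<in>cbox lo hi. \<forall>u v. f \<mu> u v = (\<Sum>i<Q. \<theta> i \<mu> * b i u v)"
    using assms unfolding separable_bilinear_def by (elim exE conjE) (rule that)
  have C1: "\<forall>q<Q. box_C1 lo hi (\<theta> q)" using Q(1) C2_loclip_imp_box_C1 by blast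
  have f: "\<forall>\<mu>\<in>cbox lo hi. f \<mu> u v = (\<Sum>i<Q. \<theta> i \<mu> * b i u v)" for u v using Q(2) by blast
  show "box_C1 lo hi (\<lambda>\<mu>. f \<mu> u v)" by (rule box_C1_lincomb(1)[OF C1 f])
  assume \<mu>: "\<mu> \<in> cbox lo hi"
  show "bilinear (\<lambda>u v. pdiff lo hi (\<lambda>\<mu>. f \<mu> u v) i \<mu>)"
    unfolding box_C1_lincomb(2)[OF C1 f \<mu>] bilinear_def
    using Q(1) unfolding bilinear_def by (auto intro!: linear_compose_sum linear_compose_scale_right[where 'b = real, simplified])
qed

lemma separable_linear_box_C1:
  fixes lo hi :: "real^'p::finite"
  assumes "separable_linear (cbox lo hi) f"
  shows "box_C1 lo hi (\<lambda>\<mu>. f \<mu> v)"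
    and "\<mu> \<in> cbox lo hi \<Longrightarrow> linear (\<lambda>v. pdiff lo hi (\<lambda>\<mu>. f \<mu> v) i \<mu>)"
proof -
  obtain Q :: nat and \<theta> b where Q: "\<forall>i<Q. linear (b i) \<and> C2_loclip_on (cbox lo hi) (\<theta> i)"
      "\<forall>\<mu>\<in>cbox lo hi. \<forall>v. f \<mu> v = (\<Sum>i<Q. \<theta> i \<mu> * b i v)"
    using assms unfolding separable_linear_def by (elim exE conjE) (rule that)
  have C1: "\<forall>q<Q. box_C1 lo hi (\<theta> q)" using Q(1) C2_loclip_imp_box_C1 by blast
  have f: "\<forall>\<mu>\<in>cbox lo hi. f \<mu> v = (\<Sum>i<Q. \<theta> i \<mu> * b i v)" for v using Q(2) by blast
  show "box_C1 lo hi (\<lambda>\<mu>. f \<mu> v)" by (rule box_C1_lincomb(1)[OF C1 f])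
  assume \<mu>: "\<mu> \<in> cbox lo hi"
  show "linear (\<lambda>v. pdiff lo hi (\<lambda>\<mu>. f \<mu> v) i \<mu>)"
    unfolding box_C1_lincomb(2)[OF C1 f \<mu>]
    using Q(1) by (auto intro!: linear_compose_sum linear_compose_scale_right[where 'b = real, simplified])
qed

section \<open>The projection onto the box and the projected gradient step\<close>

lemma clamp_nth:
  fixes lo hi x :: "real^'p::finite"
  assumes "\<And>i. lo $ i \<le> hi $ i"
  shows "clamp lo hi x $ i = max (lo $ i) (min (hi $ i) (x $ i))"
proof -
  have le: "\<forall>i\<in>Basis. lo \<bullet> i \<le> hi \<bullet> i"
    using assms by (auto simp: Basis_vec_def inner_axis)
  have "clamp lo hi x $ i = clamp lo hi x \<bullet> axis i 1" by (simp add: inner_axis)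
  also have "\<dots> = (if x \<bullet> axis i 1 < lo \<bullet> axis i 1 then lo \<bullet> axis i 1
      else if x \<bullet> axis i 1 \<le> hi \<bullet> axis i 1 then x \<bullet> axis i 1 else hi \<bullet> axis i 1)"
    unfolding clamp_def if_P[OF le] by (subst inner_sum_left_Basis) (auto simp: axis_in_Basis_iff)
  finally show ?thesis using assms[of i] by (auto simp: inner_axis max_def min_def)
qed

lemma clamp_in_cbox:
  fixes lo hi x :: "real^'p::finite"
  assumes "\<And>i. lo $ i \<le> hi $ i"
  shows "clamp lo hi x \<in> cbox lo hi"
  using assms by (auto simp: mem_box_cart clamp_nth)

text \<open>The variational inequality of the projection, tested with \<open>x\<close> itself. It is
  checked in each coordinate, where the projected point \<open>y\<close> of \<open>a - s\<close>
  satisfies \<open>(y - a) * (y - a + s) \<le> 0\<close> for every \<open>a\<close> in the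
  interval.\<close>

lemma inner_clamp_step_le:
  fixes lo hi x g :: "real^'p::finite"
  assumes "\<And>i. lo $ i \<le> hi $ i" "x \<in> cbox lo hi" "t > 0"
  shows "g \<bullet> (clamp lo hi (x - t *\<^sub>R g) - x) \<le> - (1 / t) * (norm (clamp lo hi (x - t *\<^sub>R g) - x))\<^sup>2"
proof -
  let ?y = "clamp lo hi (x - t *\<^sub>R g)"
  have *: "t * (g $ i * (?y $ i - x $ i)) \<le> - (?y $ i - x $ i)\<^sup>2" for i
  proof -
    have x: "lo $ i \<le> x $ i" "x $ i \<le> hi $ i" using assms(2) by (auto simp: mem_box_cart)
    have "(max l (min h (a - s)) - a) * (max l (min h (a - s)) - a + s) \<le> 0"
      if "l \<le> a" "a \<le> h" for l h a s :: real
      using that by (auto simp: max_def min_def mult_le_0_iff)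
    from this[OF x, of "t * g $ i"]
    have "(?y $ i - x $ i) * (?y $ i - x $ i + t * g $ i) \<le> 0"
      by (simp add: clamp_nth[OF assms(1)])
    then show ?thesis by (simp add: power2_eq_square algebra_simps)
  qed
  have "t * (g \<bullet> (?y - x)) = (\<Sum>i\<in>UNIV. t * (g $ i * (?y $ i - x $ i)))"
    by (simp add: inner_vec_def sum_distrib_left)
  also have "\<dots> \<le> (\<Sum>i\<in>UNIV. - (?y $ i - x $ i)\<^sup>2)" by (intro sum_mono *)
  also have "\<dots> = - (norm (?y - x))\<^sup>2"
    by (simp only: power2_norm_eq_inner inner_vec_def) (simp add: sum_negf power2_eq_square)
  finally show ?thesis using assms(3) by (simp add: field_simps)
qed

text \<open>For \<open>g \<ge> 0\<close> the displacement is the smaller of \<open>t * g\<close> and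
  the distance to the lower end. Shrinking \<open>t\<close> from \<open>1\<close> shrinks the first
  quantity by the factor \<open>t\<close> and leaves the second unchanged. Negative \<open>g\<close>
  is the mirror image.\<close>

lemma interval_projection_step:
  fixes a l h g t :: real
  assumes "l \<le> a" "a \<le> h" "0 < t" "t \<le> 1"
  shows "t * \<bar>a - max l (min h (a - g))\<bar> \<le> \<bar>max l (min h (a - t * g)) - a\<bar>"
proof -
  have m: "t * b \<le> b" if "0 \<le> b" for b using that assms(4) mult_right_mono[of t 1 b] by simp
  have le: "t * (h - a) \<le> h - a" "t * (a - l) \<le> a - l" using assms by (auto intro: m)
  show ?thesis
  proof (cases "g \<ge> 0")
    case True
    then have "0 \<le> t * g" using assms(3) by simp
    then have "\<bar>max l (min h (a - t * g)) - a\<bar> = min (t * g) (a - l)"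
      using assms by (auto simp: max_def min_def)
    moreover have "\<bar>a - max l (min h (a - g))\<bar> = min g (a - l)"
      using assms True by (auto simp: max_def min_def)
    moreover have "t * min g (a - l) \<le> t * g" "t * min g (a - l) \<le> t * (a - l)"
      using assms(3) by (simp_all add: mult_left_mono)
    ultimately show ?thesis using le by simp
  next
    case False
    then have "t * g \<le> 0" using assms(3) by (simp add: mult_le_0_iff)
    then have "\<bar>max l (min h (a - t * g)) - a\<bar> = min (- (t * g)) (h - a)"
      using assms by (auto simp: max_def min_def)
    moreover have "\<bar>a - max l (min h (a - g))\<bar> = min (- g) (h - a)"
      using assms False by (auto simp: max_def min_def)
    moreover have "t * min (- g) (h - a) \<le> t * (- g)" "t * min (- g) (h - a) \<le> t * (h - a)"
      using assms(3) by (intro mult_left_mono; simp)+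
    ultimately show ?thesis using le by simp
  qed
qed

text \<open>With \<open>g\<close> the gradient, the norm on the left is \<open>crit\<close>; so if
  steps whose length factor is bounded below move the point less and less, criticality
  follows.\<close>

lemma norm_clamp_step_ge:
  fixes lo hi x g :: "real^'p::finite"
  assumes "\<And>i. lo $ i \<le> hi $ i" "x \<in> cbox lo hi" "0 < t" "t \<le> 1"
  shows "t * norm (x - clamp lo hi (x - g)) \<le> norm (clamp lo hi (x - t *\<^sub>R g) - x)"
proof -
  have "norm (t *\<^sub>R (x - clamp lo hi (x - g))) \<le> norm (clamp lo hi (x - t *\<^sub>R g) - x)"
  proof (rule norm_le_componentwise_cart)
    fix i
    have "lo $ i \<le> x $ i" "x $ i \<le> hi $ i" using assms(2) by (auto simp: mem_box_cart)
    from interval_projection_step[OF this assms(3,4), of "g $ i"]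
    show "norm ((t *\<^sub>R (x - clamp lo hi (x - g))) $ i) \<le> norm ((clamp lo hi (x - t *\<^sub>R g) - x) $ i)"
      using assms(3) by (simp add: clamp_nth[OF assms(1)] abs_mult)
  qed
  then show ?thesis using assms(3) by simp
qed

text \<open>The classical mean value theorem along the segment from \<open>x\<close> to
  \<open>y\<close>, which stays in the box by convexity. The distance bound on \<open>z\<close> is
  recorded so that a Lipschitz gradient at \<open>z\<close> can be compared with the gradient at
  \<open>x\<close>.\<close>

lemma box_mean_value:
  fixes lo hi x y :: "real^'p::finite"
  assumes f: "C2_loclip_on (cbox lo hi) f" and xy: "x \<in> cbox lo hi" "y \<in> cbox lo hi"
  obtains z where "z \<in> cbox lo hi" "norm (z - x) \<le> norm (y - x)" "f y - f x = grad lo hi f z \<bullet> (y - x)"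
proof -
  obtain f' :: "real^'p \<Rightarrow> (real^'p) \<Rightarrow>\<^sub>L real" where f':
      "\<And>x. x \<in> cbox lo hi \<Longrightarrow> (f has_derivative blinfun_apply (f' x)) (at x within cbox lo hi)"
    using f unfolding C2_loclip_on_def by auto
  let ?p = "\<lambda>s. x + s *\<^sub>R (y - x)"
  have p: "?p s \<in> cbox lo hi" if "s \<in> {0..1}" for s
  proof -
    have "(1 - s) *\<^sub>R x + s *\<^sub>R y \<in> cbox lo hi"
      using convex_box(1)[of lo hi] xy that unfolding convex_alt by auto
    then show ?thesis by (simp add: algebra_simps)
  qed
  have "((\<lambda>s. f (?p s)) has_derivative (\<lambda>h. f' (?p s) (h *\<^sub>R (y - x)))) (at s within {0..1})"
    if "0 \<le> s" "s \<le> 1" for s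
  proof (rule has_derivative_in_compose[where f = ?p and g = f and f' = "\<lambda>h. h *\<^sub>R (y - x)"])
    show "(?p has_derivative (\<lambda>h. h *\<^sub>R (y - x))) (at s within {0..1})"
      by (auto intro!: derivative_eq_intros)
    show "(f has_derivative f' (?p s)) (at (?p s) within ?p ` {0..1})"
      by (rule has_derivative_subset[OF f'[OF p]]) (use p that in auto)
  qed
  then obtain s where s: "s \<in> {0<..<1}" "f (?p 1) - f (?p 0) = f' (?p s) ((1 - 0) *\<^sub>R (y - x))"
    using mvt_simple[of 0 1 "\<lambda>s. f (?p s)" "\<lambda>s h. f' (?p s) (h *\<^sub>R (y - x))"] by auto
  let ?z = "?p s"
  have z: "?z \<in> cbox lo hi" using p[of s] s(1) by auto
  have "f' ?z (y - x) = f' ?z (\<Sum>i\<in>UNIV. (y - x) $ i *\<^sub>R axis i 1)"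
    using basis_expansion[of "y - x"] by (simp add: scalar_mult_eq_scaleR)
  also have "\<dots> = (\<Sum>i\<in>UNIV. (y - x) $ i * f' ?z (axis i 1))"
    by (simp add: blinfun.sum_right blinfun.scaleR_right)
  also have "\<dots> = (\<Sum>i\<in>UNIV. grad lo hi f ?z $ i * (y - x) $ i)"
  proof (rule sum.cong[OF refl])
    fix i
    show "(y - x) $ i * f' ?z (axis i 1) = grad lo hi f ?z $ i * (y - x) $ i"
    proof (cases "lo $ i = hi $ i")
      \<comment> \<open>The gradient component is \<open>0\<close> here by convention, whatever the
        Frechet derivative says; the identity survives because \<open>x\<close> and \<open>y\<close>
        agree in this coordinate.\<close>
      case True
      then have "(y - x) $ i = 0"
        using xy(1)[unfolded mem_box_cart, rule_format, of i] xy(2)[unfolded mem_box_cart, rule_format, of i]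
        by simp
      then show ?thesis by simp
    next
      case False
      show ?thesis unfolding grad_def using pdiff_eq_has_derivative[OF f'[OF z] z False] by simp
    qed
  qed
  finally have "f y - f x = grad lo hi f ?z \<bullet> (y - x)" using s(2) by (simp add: inner_vec_def)
  moreover have "norm (?z - x) \<le> norm (y - x)" using s(1) by (simp add: mult_left_le_one_le)
  ultimately show ?thesis using that z by blast
qed

text \<open>The mean value theorem, the Lipschitz bound and the variational inequality give
  \<open>f y - f x \<le> (L - 1 / t) * (norm (y - x))\<^sup>2\<close>. The condition
  \<open>t * L \<le> 1 - c\<close> says exactly that this factor is at most
  \<open>- (c / t)\<close>; the threshold \<open>(1 - kappa_arm) / C_L\<close> for the backtracking
  steps comes from here.\<close>

lemma projected_gradient_armijo:
  fixes lo hi x :: "real^'p::finite"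
  assumes box: "\<And>i. lo $ i \<le> hi $ i" and f: "C2_loclip_on (cbox lo hi) f"
    and lip: "\<forall>\<mu>\<in>cbox lo hi. \<forall>\<nu>\<in>cbox lo hi. norm (grad lo hi f \<mu> - grad lo hi f \<nu>) \<le> L * norm (\<mu> - \<nu>)"
    and x: "x \<in> cbox lo hi" and t: "0 < t" "t * L \<le> 1 - c" and L: "L \<ge> 0"
  defines "y \<equiv> clamp lo hi (x - t *\<^sub>R grad lo hi f x)"
  shows "f y - f x \<le> - (c / t) * (norm (y - x))\<^sup>2"
proof -
  let ?g = "grad lo hi f"
  have y: "y \<in> cbox lo hi" unfolding y_def using box by (rule clamp_in_cbox)
  obtain z where z: "z \<in> cbox lo hi" "norm (z - x) \<le> norm (y - x)" "f y - f x = ?g z \<bullet> (y - x)"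
    by (rule box_mean_value[OF f x y])
  have "(?g z - ?g x) \<bullet> (y - x) \<le> norm (?g z - ?g x) * norm (y - x)" by (rule norm_cauchy_schwarz)
  also have "\<dots> \<le> (L * norm (z - x)) * norm (y - x)"
    using lip z(1) x by (intro mult_right_mono) auto
  also have "\<dots> \<le> (L * norm (y - x)) * norm (y - x)"
    using z(2) L by (intro mult_right_mono mult_left_mono) auto
  finally have 1: "(?g z - ?g x) \<bullet> (y - x) \<le> L * (norm (y - x))\<^sup>2" by (simp add: power2_eq_square mult.assoc)
  have 2: "?g x \<bullet> (y - x) \<le> - (1 / t) * (norm (y - x))\<^sup>2"
    unfolding y_def by (rule inner_clamp_step_le[OF box x t(1)])
  have "f y - f x \<le> (L - 1 / t) * (norm (y - x))\<^sup>2"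
    using 1 2 z(3) by (simp add: inner_diff_left algebra_simps)
  also have "\<dots> \<le> - (c / t) * (norm (y - x))\<^sup>2"
  proof (rule mult_right_mono)
    have "L \<le> (1 - c) / t" using t by (simp add: pos_le_divide_eq mult.commute)
    then show "L - 1 / t \<le> - (c / t)" by (simp add: diff_divide_distrib)
  qed simp
  finally show ?thesis .
qed

section \<open>Regularity of the reduced solutions and functionals\<close>

locale smooth_problem =
  fixes D :: "('v::{real_inner,complete_space}, 'p::finite) problem"
  assumes wf: "wf_problem D" and smooth: "separable_smooth D"
begin

section \<open>Properties of the forms and unique solvability\<close>

lemma box_le: "mu_lo D $ i \<le> mu_hi D $ i"
  using wf unfolding wf_problem_def by blast

lemma fin_dim_Vh: "fin_dim (Vh D)"
  using wf unfolding wf_problem_def fin_dim_def by blast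

lemma forms:
  assumes "\<mu> \<in> Pset D"
  shows "bilinear (form_a D \<mu>)" "coercive (form_a D \<mu>)" "linear (form_l D \<mu>)" "linear (form_j D \<mu>)"
    "bilinear (form_k D \<mu>)" "form_k D \<mu> u v = form_k D \<mu> v u"
proof -
  have *: "bounded_bilinear (form_a D \<mu>) \<and> coercive (form_a D \<mu>) \<and>
        bounded_linear (form_l D \<mu>) \<and> bounded_linear (form_j D \<mu>) \<and>
        bounded_bilinear (form_k D \<mu>) \<and> (\<forall>u v. form_k D \<mu> u v = form_k D \<mu> v u)"
    using wf assms unfolding wf_problem_def by blast
  then show "bilinear (form_a D \<mu>)" "coercive (form_a D \<mu>)" "linear (form_l D \<mu>)" "linear (form_j D \<mu>)"
    "bilinear (form_k D \<mu>)" "form_k D \<mu> u v = form_k D \<mu> v u"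
    using bilinear_of_bounded bounded_linear.linear by blast+
qed

lemma form_a_pos:
  assumes "\<mu> \<in> Pset D" "u \<noteq> 0"
  shows "form_a D \<mu> u u > 0"
proof -
  obtain \<alpha> where "\<alpha> > 0" "\<alpha> * (norm u)\<^sup>2 \<le> form_a D \<mu> u u"
    using forms(2)[OF assms(1)] unfolding coercive_def by auto
  moreover have "\<alpha> * (norm u)\<^sup>2 > 0" using assms(2) \<open>\<alpha> > 0\<close> by simp
  ultimately show ?thesis by linarith
qed

lemma forms_C1:
  "box_C1 (mu_lo D) (mu_hi D) (\<lambda>\<mu>. form_a D \<mu> u v)"
  "box_C1 (mu_lo D) (mu_hi D) (\<lambda>\<mu>. form_l D \<mu> v)"
  "box_C1 (mu_lo D) (mu_hi D) (\<lambda>\<mu>. form_j D \<mu> v)"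
  "box_C1 (mu_lo D) (mu_hi D) (\<lambda>\<mu>. form_k D \<mu> u v)"
  "box_C1 (mu_lo D) (mu_hi D) (Theta D)"
  using smooth unfolding separable_smooth_def
  by (auto intro: separable_bilinear_box_C1 separable_linear_box_C1 C2_loclip_imp_box_C1)

lemma pd_forms:
  assumes "\<mu> \<in> Pset D"
  shows "bilinear (\<lambda>u v. pd D (\<lambda>\<mu>. form_a D \<mu> u v) i \<mu>)" "linear (\<lambda>v. pd D (\<lambda>\<mu>. form_l D \<mu> v) i \<mu>)"
    "linear (\<lambda>v. pd D (\<lambda>\<mu>. form_j D \<mu> v) i \<mu>)" "bilinear (\<lambda>u v. pd D (\<lambda>\<mu>. form_k D \<mu> u v) i \<mu>)"
  using smooth assms unfolding separable_smooth_def
  by (auto intro: separable_bilinear_box_C1 separable_linear_box_C1)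

lemma linear_dual_rhs:
  assumes "\<mu> \<in> Pset D"
  shows "linear (\<lambda>q. form_j D \<mu> q + 2 * form_k D \<mu> q u)"
  using forms(4)[OF assms] bilinear_lin(2)[OF forms(5)[OF assms]]
  by (intro linear_compose_add linear_compose_scale_right[where 'b = real, simplified])

lemma primal_ex1:
  assumes "fin_dim W" "\<mu> \<in> Pset D"
  shows "\<exists>!u. u \<in> W \<and> (\<forall>v\<in>W. r_pr D \<mu> u v = 0)"
proof -
  have "\<exists>!u. u \<in> W \<and> (\<forall>v\<in>W. form_a D \<mu> u v = form_l D \<mu> v)"
    by (rule galerkin_exists[OF assms(1) forms(1)[OF assms(2)] _ forms(3)[OF assms(2)]])
       (rule form_a_pos[OF assms(2)])
  then show ?thesis
    by (simp only: r_pr_def right_minus_eq eq_commute[of "form_l D \<mu> v" for v])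
qed

lemma dual_ex1:
  assumes "fin_dim W" "\<mu> \<in> Pset D"
  shows "\<exists>!p. p \<in> W \<and> (\<forall>q\<in>W. r_du D \<mu> u p q = 0)"
proof -
  have "\<exists>!p. p \<in> W \<and> (\<forall>q\<in>W. form_a D \<mu> q p = form_j D \<mu> q + 2 * form_k D \<mu> q u)"
    by (rule galerkin_exists[OF assms(1) bilinear_flip[OF forms(1)[OF assms(2)]] _
          linear_dual_rhs[OF assms(2)]])
       (rule form_a_pos[OF assms(2)])
  then show ?thesis
    by (simp only: r_du_def right_minus_eq eq_commute[of "form_j D \<mu> q + x" for q x])
qed

lemma primal_solution:
  assumes "fin_dim W" "\<mu> \<in> Pset D"
  shows "primal D W \<mu> \<in> W" "v \<in> W \<Longrightarrow> form_a D \<mu> (primal D W \<mu>) v = form_l D \<mu> v"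
  using theI'[OF primal_ex1[OF assms]] unfolding primal_def r_pr_def by auto

lemma primal_eqI:
  assumes "fin_dim W" "\<mu> \<in> Pset D" "u \<in> W" "\<And>v. v \<in> W \<Longrightarrow> form_a D \<mu> u v = form_l D \<mu> v"
  shows "primal D W \<mu> = u"
  unfolding primal_def using assms(3,4)
  by (intro the1_equality[OF primal_ex1[OF assms(1,2)]]) (simp add: r_pr_def)

lemma dual_solution:
  assumes "fin_dim W" "\<mu> \<in> Pset D"
  shows "dual D W u \<mu> \<in> W"
    "q \<in> W \<Longrightarrow> form_a D \<mu> q (dual D W u \<mu>) = form_j D \<mu> q + 2 * form_k D \<mu> q u"
  using theI'[OF dual_ex1[OF assms, of u]] unfolding dual_def r_du_def by auto

lemma dual_eqI:
  assumes "fin_dim W" "\<mu> \<in> Pset D" "p \<in> W"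
    "\<And>q. q \<in> W \<Longrightarrow> form_a D \<mu> q p = form_j D \<mu> q + 2 * form_k D \<mu> q u"
  shows "dual D W u \<mu> = p"
  unfolding dual_def using assms(3,4)
  by (intro the1_equality[OF dual_ex1[OF assms(1,2)]]) (simp add: r_du_def)

text \<open>Both spaces are kept inside \<open>Vh D\<close> so that the full order equations may be
  tested with reduced functions and their derivatives.\<close>

definition model :: "'v rb \<Rightarrow> bool" where
  "model M \<longleftrightarrow> fin_dim (fst M) \<and> fin_dim (snd M) \<and> fst M \<subseteq> Vh D \<and> snd M \<subseteq> Vh D"

lemma model_full: "model (Vh D, Vh D)"
  unfolding model_def using fin_dim_Vh by simp

lemma modelD:
  assumes "model M"
  shows "fin_dim (fst M)" "fin_dim (snd M)" "fst M \<subseteq> Vh D" "snd M \<subseteq> Vh D"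
  using assms unfolding model_def by auto

text \<open>The full order problem is the model with both spaces equal to \<open>Vh D\<close>, so
  continuity and differentiability need to be proved only once, for reduced states.\<close>

lemma u_h_eq: "u_h D = u_r D (Vh D, Vh D)" and p_h_eq: "p_h D = p_r D (Vh D, Vh D)"
  by (auto simp: fun_eq_iff u_h_def u_r_def p_h_def p_r_def)

lemma reduced_solution:
  assumes "model M" "\<mu> \<in> Pset D"
  shows "u_r D M \<mu> \<in> fst M" "p_r D M \<mu> \<in> snd M" "u_r D M \<mu> \<in> Vh D" "p_r D M \<mu> \<in> Vh D"
    "v \<in> fst M \<Longrightarrow> form_a D \<mu> (u_r D M \<mu>) v = form_l D \<mu> v"
    "q \<in> snd M \<Longrightarrow> form_a D \<mu> q (p_r D M \<mu>) = form_j D \<mu> q + 2 * form_k D \<mu> q (u_r D M \<mu>)"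
  unfolding u_r_def p_r_def
  using primal_solution[OF modelD(1)[OF assms(1)] assms(2)] dual_solution[OF modelD(2)[OF assms(1)] assms(2)]
    modelD(3,4)[OF assms(1)] by auto

lemma truth_solution:
  assumes "\<mu> \<in> Pset D"
  shows "u_h D \<mu> \<in> Vh D" "p_h D \<mu> \<in> Vh D"
    "v \<in> Vh D \<Longrightarrow> form_a D \<mu> (u_h D \<mu>) v = form_l D \<mu> v"
    "q \<in> Vh D \<Longrightarrow> form_a D \<mu> q (p_h D \<mu>) = form_j D \<mu> q + 2 * form_k D \<mu> q (u_h D \<mu>)"
  using reduced_solution[OF model_full assms] unfolding u_h_eq p_h_eq by auto

text \<open>\<open>J_h\<close> carries no correction term, but the correction of the full model is
  the primal residual tested with \<open>p_h D \<mu>\<close>, which lies in \<open>Vh D\<close> and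
  hence gives zero.\<close>

lemma J_h_eq:
  assumes "\<mu> \<in> Pset D"
  shows "J_h D \<mu> = J_r D (Vh D, Vh D) \<mu>"
  using truth_solution(3)[OF assms truth_solution(2)[OF assms]]
  unfolding J_h_def J_r_def u_h_eq[symmetric] p_h_eq[symmetric] r_pr_def by simp

lemma reproduces_truth:
  assumes "model M" "\<mu> \<in> Pset D" "u_h D \<mu> \<in> fst M" "p_h D \<mu> \<in> snd M"
  shows "u_r D M \<mu> = u_h D \<mu>" "p_r D M \<mu> = p_h D \<mu>"
proof -
  show u: "u_r D M \<mu> = u_h D \<mu>"
    unfolding u_r_def using truth_solution[OF assms(2)] modelD[OF assms(1)] assms(2,3)
    by (intro primal_eqI) auto
  show "p_r D M \<mu> = p_h D \<mu>"
    unfolding p_r_def u using truth_solution[OF assms(2)] modelD[OF assms(1)] assms(2,4)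
    by (intro dual_eqI) auto
qed

section \<open>Continuity of the reduced states in the parameter\<close>

lemma Pset_tendsto:
  assumes "continuous_on (Pset D) g" "(\<nu> \<longlongrightarrow> \<mu>) F" "\<mu> \<in> Pset D" "eventually (\<lambda>s. \<nu> s \<in> Pset D) F"
  shows "((\<lambda>s. g (\<nu> s)) \<longlongrightarrow> g \<mu>) F"
  using assms by (rule continuous_on_tendsto_compose)

lemma u_r_tendsto:
  assumes M: "model M" and \<nu>: "(\<nu> \<longlongrightarrow> \<mu>) F" "\<mu> \<in> Pset D" "eventually (\<lambda>s. \<nu> s \<in> Pset D) F"
  shows "((\<lambda>s. u_r D M (\<nu> s)) \<longlongrightarrow> u_r D M \<mu>) F"
proof (rule galerkin_tendsto[OF modelD(1)[OF M], where a = "\<lambda>s. form_a D (\<nu> s)" and f = "\<lambda>s. form_l D (\<nu> s)"])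
  show "eventually (\<lambda>s. bilinear (form_a D (\<nu> s))) F" "eventually (\<lambda>s. linear (form_l D (\<nu> s))) F"
    by (rule eventually_mono[OF \<nu>(3)], rule forms, assumption)+
  show "eventually (\<lambda>s. u_r D M (\<nu> s) \<in> fst M \<and>
      (\<forall>v\<in>fst M. form_a D (\<nu> s) (u_r D M (\<nu> s)) v = form_l D (\<nu> s) v)) F"
    using \<nu>(3) by eventually_elim (use reduced_solution[OF M] in auto)
  show "((\<lambda>s. form_a D (\<nu> s) u v) \<longlongrightarrow> form_a D \<mu> u v) F" for u v
    by (rule Pset_tendsto[OF box_C1_D(1)[OF forms_C1(1)] \<nu>])
  show "((\<lambda>s. form_l D (\<nu> s) v) \<longlongrightarrow> form_l D \<mu> v) F" for v
    by (rule Pset_tendsto[OF box_C1_D(1)[OF forms_C1(2)] \<nu>])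
qed (use forms[OF \<nu>(2)] reduced_solution[OF M \<nu>(2)] in auto)

text \<open>The right-hand side of the dual problem contains the primal state, which moves with the
  parameter together with \<open>form_k\<close>. Continuity of the primal state and the joint limit
  in finite dimension take care of this; the form appears with its arguments exchanged.\<close>

lemma p_r_tendsto:
  assumes M: "model M" and \<nu>: "(\<nu> \<longlongrightarrow> \<mu>) F" "\<mu> \<in> Pset D" "eventually (\<lambda>s. \<nu> s \<in> Pset D) F"
  shows "((\<lambda>s. p_r D M (\<nu> s)) \<longlongrightarrow> p_r D M \<mu>) F"
proof (rule galerkin_tendsto[OF modelD(2)[OF M], where a = "\<lambda>s u v. form_a D (\<nu> s) v u" and
      f = "\<lambda>s q. form_j D (\<nu> s) q + 2 * form_k D (\<nu> s) q (u_r D M (\<nu> s))"])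
  show "eventually (\<lambda>s. bilinear (\<lambda>u v. form_a D (\<nu> s) v u)) F"
    "eventually (\<lambda>s. linear (\<lambda>q. form_j D (\<nu> s) q + 2 * form_k D (\<nu> s) q (u_r D M (\<nu> s)))) F"
    by (rule eventually_mono[OF \<nu>(3)], auto intro: forms linear_dual_rhs bilinear_flip)+
  show "eventually (\<lambda>s. p_r D M (\<nu> s) \<in> snd M \<and> (\<forall>q\<in>snd M. form_a D (\<nu> s) q (p_r D M (\<nu> s)) =
      form_j D (\<nu> s) q + 2 * form_k D (\<nu> s) q (u_r D M (\<nu> s)))) F"
    using \<nu>(3) by eventually_elim (use reduced_solution[OF M] in auto)
  show "((\<lambda>s. form_a D (\<nu> s) v u) \<longlongrightarrow> form_a D \<mu> v u) F" for u v
    by (rule Pset_tendsto[OF box_C1_D(1)[OF forms_C1(1)] \<nu>])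
  have "((\<lambda>s. form_k D (\<nu> s) q (u_r D M (\<nu> s))) \<longlongrightarrow> form_k D \<mu> q (u_r D M \<mu>)) F" for q
  proof (rule tendsto_linear_fin_dim[OF modelD(1)[OF M] _ _ u_r_tendsto[OF M \<nu>]])
    show "eventually (\<lambda>s. u_r D M (\<nu> s) \<in> fst M) F" "eventually (\<lambda>s. linear (form_k D (\<nu> s) q)) F"
      by (rule eventually_mono[OF \<nu>(3)], auto intro: reduced_solution[OF M] forms bilinear_lin)+
    show "((\<lambda>s. form_k D (\<nu> s) q v) \<longlongrightarrow> form_k D \<mu> q v) F" for v
      by (rule Pset_tendsto[OF box_C1_D(1)[OF forms_C1(4)] \<nu>])
  qed (use \<nu>(2) in \<open>auto intro: reduced_solution[OF M] forms bilinear_lin\<close>)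
  then show "((\<lambda>s. form_j D (\<nu> s) q + 2 * form_k D (\<nu> s) q (u_r D M (\<nu> s)))
      \<longlongrightarrow> form_j D \<mu> q + 2 * form_k D \<mu> q (u_r D M \<mu>)) F" for q
    by (intro tendsto_intros Pset_tendsto[OF box_C1_D(1)[OF forms_C1(3)] \<nu>])
qed (use \<nu>(2) reduced_solution[OF M \<nu>(2)] in \<open>auto intro: forms linear_dual_rhs bilinear_flip coercive_flip\<close>)

section \<open>Derivatives of the states and of the functionals along the axes\<close>

abbreviation seg :: "'p \<Rightarrow> real^'p \<Rightarrow> real filter" where
  "seg i \<mu> \<equiv> at 0 within axis_seg (mu_lo D) (mu_hi D) i \<mu>"

lemma seg_tendsto:
  "((\<lambda>t. \<mu> + t *\<^sub>R axis i 1) \<longlongrightarrow> \<mu>) (seg i \<mu>)"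
  "eventually (\<lambda>t. \<mu> + t *\<^sub>R axis i 1 \<in> Pset D) (seg i \<mu>)"
proof -
  have "((\<lambda>t. \<mu> + t *\<^sub>R axis i 1) \<longlongrightarrow> \<mu> + 0 *\<^sub>R axis i 1) (seg i \<mu>)"
    by (intro tendsto_intros)
  then show "((\<lambda>t. \<mu> + t *\<^sub>R axis i 1) \<longlongrightarrow> \<mu>) (seg i \<mu>)" by simp
  show "eventually (\<lambda>t. \<mu> + t *\<^sub>R axis i 1 \<in> Pset D) (seg i \<mu>)" by (simp add: eventually_at_filter)
qed

lemma u_r_has_vector_derivative:
  assumes M: "model M" and \<mu>: "\<mu> \<in> Pset D" and i: "mu_lo D $ i \<noteq> mu_hi D $ i"
  shows "\<exists>u'\<in>fst M. ((\<lambda>t. u_r D M (\<mu> + t *\<^sub>R axis i 1)) has_vector_derivative u') (seg i \<mu>)"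
  by (rule galerkin_has_vector_derivative[OF modelD(1)[OF M],
        where a = "\<lambda>t. form_a D (\<mu> + t *\<^sub>R axis i 1)" and f = "\<lambda>t. form_l D (\<mu> + t *\<^sub>R axis i 1)"
        and da = "\<lambda>u v. pd D (\<lambda>\<mu>. form_a D \<mu> u v) i \<mu>" and df = "\<lambda>v. pd D (\<lambda>\<mu>. form_l D \<mu> v) i \<mu>"])
     (use \<mu> i in \<open>auto intro: forms pd_forms box_C1_D(3) forms_C1 reduced_solution[OF M]\<close>)

lemma p_r_has_vector_derivative:
  assumes M: "model M" and \<mu>: "\<mu> \<in> Pset D" and i: "mu_lo D $ i \<noteq> mu_hi D $ i"
  shows "\<exists>p'\<in>snd M. ((\<lambda>t. p_r D M (\<mu> + t *\<^sub>R axis i 1)) has_vector_derivative p') (seg i \<mu>)"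
proof -
  let ?\<nu> = "\<lambda>t. \<mu> + t *\<^sub>R axis i 1"
  let ?u = "\<lambda>t. u_r D M (?\<nu> t)"
  let ?w = "u_r D M \<mu>"
  obtain u' where u': "u' \<in> fst M" "(?u has_vector_derivative u') (seg i \<mu>)"
    using u_r_has_vector_derivative[OF assms] by blast
  have sub: "subspace (fst M)" by (rule fin_dim_subspace[OF modelD(1)[OF M]])
  have dk: "((\<lambda>t. form_k D (?\<nu> t) q (?u t)) has_vector_derivative
      form_k D \<mu> q u' + pd D (\<lambda>\<nu>. form_k D \<nu> q ?w) i \<mu>) (seg i \<mu>)" for q
    unfolding has_vector_derivative_iff_quotient
  proof (rule Lim_transform_eventually)
    show "((\<lambda>t. form_k D (?\<nu> t) q ((1 / t) *\<^sub>R (?u t - ?u 0)) +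
        (1 / t) *\<^sub>R (form_k D (?\<nu> t) q ?w - form_k D (?\<nu> 0) q ?w))
      \<longlongrightarrow> form_k D \<mu> q u' + pd D (\<lambda>\<nu>. form_k D \<nu> q ?w) i \<mu>) (seg i \<mu>)"
    proof (rule tendsto_add)
      show "((\<lambda>t. form_k D (?\<nu> t) q ((1 / t) *\<^sub>R (?u t - ?u 0))) \<longlongrightarrow> form_k D \<mu> q u') (seg i \<mu>)"
      proof (rule tendsto_linear_fin_dim[OF modelD(1)[OF M] u'(1) _
            u'(2)[unfolded has_vector_derivative_iff_quotient]])
        show "eventually (\<lambda>t. (1 / t) *\<^sub>R (?u t - ?u 0) \<in> fst M) (seg i \<mu>)"
          using seg_tendsto(2)
          by eventually_elim (intro subspace_scale subspace_diff sub reduced_solution[OF M]; simp add: \<mu>)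
        show "eventually (\<lambda>t. linear (form_k D (?\<nu> t) q)) (seg i \<mu>)"
          using seg_tendsto(2) by eventually_elim (intro bilinear_lin forms)
        show "linear (form_k D \<mu> q)" by (intro bilinear_lin forms \<mu>)
        show "((\<lambda>t. form_k D (?\<nu> t) q v) \<longlongrightarrow> form_k D \<mu> q v) (seg i \<mu>)" for v
          by (rule Pset_tendsto[OF box_C1_D(1)[OF forms_C1(4)] seg_tendsto(1) \<mu> seg_tendsto(2)])
      qed
      show "((\<lambda>t. (1 / t) *\<^sub>R (form_k D (?\<nu> t) q ?w - form_k D (?\<nu> 0) q ?w))
          \<longlongrightarrow> pd D (\<lambda>\<nu>. form_k D \<nu> q ?w) i \<mu>) (seg i \<mu>)"
        by (rule box_C1_D(3)[OF forms_C1(4) \<mu> i, unfolded has_vector_derivative_iff_quotient])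
    qed
    show "eventually (\<lambda>t. form_k D (?\<nu> t) q ((1 / t) *\<^sub>R (?u t - ?u 0)) +
        (1 / t) *\<^sub>R (form_k D (?\<nu> t) q ?w - form_k D (?\<nu> 0) q ?w) =
        (1 / t) *\<^sub>R (form_k D (?\<nu> t) q (?u t) - form_k D (?\<nu> 0) q (?u 0))) (seg i \<mu>)"
      using seg_tendsto(2)
    proof eventually_elim
      case (elim t)
      have "linear (form_k D (?\<nu> t) q)" by (intro bilinear_lin forms elim)
      then show ?case by (simp add: linear_diff linear_scale right_diff_distrib)
    qed
  qed
  let ?f = "\<lambda>t q. form_j D (?\<nu> t) q + 2 * form_k D (?\<nu> t) q (?u t)"
  let ?df = "\<lambda>q. pd D (\<lambda>\<nu>. form_j D \<nu> q) i \<mu> +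
          2 * (form_k D \<mu> q u' + pd D (\<lambda>\<nu>. form_k D \<nu> q ?w) i \<mu>)"
  show ?thesis
  proof (rule galerkin_has_vector_derivative[OF modelD(2)[OF M],
        where a = "\<lambda>t u v. form_a D (?\<nu> t) v u" and f = ?f
        and da = "\<lambda>u v. pd D (\<lambda>\<nu>. form_a D \<nu> v u) i \<mu>" and df = ?df])
    show "linear ?df"
      by (intro linear_compose_add linear_compose_scale_right[where 'b = real, simplified]
          bilinear_lin pd_forms forms \<mu> bilinear_lin(2)[OF pd_forms(4)])
    show "((\<lambda>t. ?f t q) has_vector_derivative ?df q) (seg i \<mu>)" for q
      by (intro has_vector_derivative_add has_vector_derivative_mult_right dk box_C1_D(3) forms_C1 \<mu> i)
  qed (use \<mu> i in \<open>auto intro: forms pd_forms bilinear_flip box_C1_D(3) forms_C1 reduced_solution[OF M]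
      linear_dual_rhs coercive_flip\<close>)
qed

text \<open>
  The partial derivative of the Lagrangian for frozen states. At the truth states the residuals
  vanish on \<open>Vh D\<close>, so that the derivatives of the states do not contribute.
\<close>

definition pd_lagrangian :: "'p \<Rightarrow> 'v \<Rightarrow> 'v \<Rightarrow> real^'p \<Rightarrow> real" where
  "pd_lagrangian i u p \<mu> = pd D (Theta D) i \<mu> + pd D (\<lambda>\<nu>. form_j D \<nu> u) i \<mu>
     + pd D (\<lambda>\<nu>. form_k D \<nu> u u) i \<mu> + pd D (\<lambda>\<nu>. form_l D \<nu> p) i \<mu> - pd D (\<lambda>\<nu>. form_a D \<nu> u p) i \<mu>"

text \<open>The sensitivities \<open>u'\<close> and \<open>p'\<close> depend on the model, but the
  value of the derivative does not. Any two models that reproduce the truth states at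
  \<open>\<mu>\<close> therefore have the same partial derivatives there.\<close>

lemma J_r_has_vector_derivative:
  assumes M: "model M" and \<mu>: "\<mu> \<in> Pset D" and i: "mu_lo D $ i \<noteq> mu_hi D $ i"
    and u0: "u_r D M \<mu> = u_h D \<mu>" and p0: "p_r D M \<mu> = p_h D \<mu>"
  shows "((\<lambda>t. J_r D M (\<mu> + t *\<^sub>R axis i 1)) has_vector_derivative
    pd_lagrangian i (u_h D \<mu>) (p_h D \<mu>) \<mu>) (seg i \<mu>)"
proof -
  let ?\<nu> = "\<lambda>t. \<mu> + t *\<^sub>R axis i 1"
  let ?u = "\<lambda>t. u_r D M (?\<nu> t)" and ?p = "\<lambda>t. p_r D M (?\<nu> t)"
  let ?uh = "u_h D \<mu>" and ?ph = "p_h D \<mu>"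
  obtain u' where u': "u' \<in> fst M" "(?u has_vector_derivative u') (seg i \<mu>)"
    using u_r_has_vector_derivative[OF M \<mu> i] by blast
  obtain p' where p': "p' \<in> snd M" "(?p has_vector_derivative p') (seg i \<mu>)"
    using p_r_has_vector_derivative[OF M \<mu> i] by blast
  define U where "U t = (1 / t) *\<^sub>R (?u t - ?u 0)" for t
  define P where "P t = (1 / t) *\<^sub>R (?p t - ?p 0)" for t
  have U: "(U \<longlongrightarrow> u') (seg i \<mu>)" and P: "(P \<longlongrightarrow> p') (seg i \<mu>)"
    using u'(2) p'(2) unfolding has_vector_derivative_iff_quotient U_def P_def .
  have V': "u' \<in> Vh D" "p' \<in> Vh D" "?uh \<in> Vh D" "?ph \<in> Vh D"
    using u'(1) p'(1) modelD[OF M] truth_solution[OF \<mu>] by auto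
  have sub: "subspace (Vh D)" by (rule fin_dim_subspace[OF fin_dim_Vh])
  have evV: "eventually (\<lambda>t. ?u t \<in> Vh D) (seg i \<mu>)" "eventually (\<lambda>t. ?p t \<in> Vh D) (seg i \<mu>)"
    by (rule eventually_mono[OF seg_tendsto(2)], rule reduced_solution[OF M], assumption)+
  have evU: "eventually (\<lambda>t. U t \<in> Vh D) (seg i \<mu>)" "eventually (\<lambda>t. P t \<in> Vh D) (seg i \<mu>)"
    unfolding U_def P_def
    by (rule eventually_mono[OF evV(1)] eventually_mono[OF evV(2)],
        intro subspace_scale subspace_diff sub; simp add: reduced_solution[OF M \<mu>])+
  have u: "(?u \<longlongrightarrow> ?uh) (seg i \<mu>)" and p: "(?p \<longlongrightarrow> ?ph) (seg i \<mu>)"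
    using u_r_tendsto[OF M seg_tendsto(1) \<mu> seg_tendsto(2)]
      p_r_tendsto[OF M seg_tendsto(1) \<mu> seg_tendsto(2)] u0 p0 by simp_all
  have evc: "eventually (\<lambda>t. w \<in> Vh D) (seg i \<mu>)" if "w \<in> Vh D" for w using that by simp
  have lims: "((\<lambda>t. form_a D (?\<nu> t) u v) \<longlongrightarrow> form_a D \<mu> u v) (seg i \<mu>)"
    "((\<lambda>t. form_k D (?\<nu> t) u v) \<longlongrightarrow> form_k D \<mu> u v) (seg i \<mu>)"
    "((\<lambda>t. form_l D (?\<nu> t) v) \<longlongrightarrow> form_l D \<mu> v) (seg i \<mu>)"
    "((\<lambda>t. form_j D (?\<nu> t) v) \<longlongrightarrow> form_j D \<mu> v) (seg i \<mu>)" for u v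
    by (rule Pset_tendsto[OF box_C1_D(1)[OF forms_C1(1)] seg_tendsto(1) \<mu> seg_tendsto(2)]
        Pset_tendsto[OF box_C1_D(1)[OF forms_C1(2)] seg_tendsto(1) \<mu> seg_tendsto(2)]
        Pset_tendsto[OF box_C1_D(1)[OF forms_C1(3)] seg_tendsto(1) \<mu> seg_tendsto(2)]
        Pset_tendsto[OF box_C1_D(1)[OF forms_C1(4)] seg_tendsto(1) \<mu> seg_tendsto(2)])+
  have evf: "eventually (\<lambda>t. bilinear (form_a D (?\<nu> t))) (seg i \<mu>)"
    "eventually (\<lambda>t. bilinear (form_k D (?\<nu> t))) (seg i \<mu>)"
    "eventually (\<lambda>t. linear (form_l D (?\<nu> t))) (seg i \<mu>)"
    "eventually (\<lambda>t. linear (form_j D (?\<nu> t))) (seg i \<mu>)"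
    by (rule eventually_mono[OF seg_tendsto(2)], rule forms, assumption)+
  note lin = tendsto_linear_fin_dim[OF fin_dim_Vh _ _ _, rotated 3]
    and bil = tendsto_bilinear_fin_dim[OF fin_dim_Vh _ _ _ _ _ _, rotated 6]
  \<comment> \<open>\<open>R\<close> collects the part of the quotient of \<open>J_r\<close> caused
    by the change of the states. The products are telescoped so that each summand contains exactly
    one of the quotients \<open>U t\<close> and \<open>P t\<close>.\<close>
  define R where "R t = form_j D (?\<nu> t) (U t) + (form_k D (?\<nu> t) (U t) (?u t) + form_k D (?\<nu> t) ?uh (U t))
      + form_l D (?\<nu> t) (P t) - (form_a D (?\<nu> t) (U t) (?p t) + form_a D (?\<nu> t) ?uh (P t))" for t
  have "(R \<longlongrightarrow> form_j D \<mu> u' + (form_k D \<mu> u' ?uh + form_k D \<mu> ?uh u') + form_l D \<mu> p'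
      - (form_a D \<mu> u' ?ph + form_a D \<mu> ?uh p')) (seg i \<mu>)"
    unfolding R_def
    by (rule tendsto_diff[OF tendsto_add[OF tendsto_add[OF
          lin[OF evf(4) forms(4)[OF \<mu>] lims(4) V'(1) evU(1) U]
          tendsto_add[OF
            bil[OF evf(2) forms(5)[OF \<mu>] lims(2) V'(1,3) evU(1) U evV(1) u]
            bil[OF evf(2) forms(5)[OF \<mu>] lims(2) V'(3,1) evc[OF V'(3)] tendsto_const evU(1) U]]]
          lin[OF evf(3) forms(3)[OF \<mu>] lims(3) V'(2) evU(2) P]]
          tendsto_add[OF
            bil[OF evf(1) forms(1)[OF \<mu>] lims(1) V'(1,4) evU(1) U evV(2) p]
            bil[OF evf(1) forms(1)[OF \<mu>] lims(1) V'(3,2) evc[OF V'(3)] tendsto_const evU(2) P]]])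
  \<comment> \<open>By symmetry the two \<open>form_k\<close> terms add up to the factor
    \<open>2\<close> of the dual equation. What remains is the dual residual tested with
    \<open>u'\<close> plus the primal residual tested with \<open>p'\<close>.\<close>
  also have "form_j D \<mu> u' + (form_k D \<mu> u' ?uh + form_k D \<mu> ?uh u') + form_l D \<mu> p'
      - (form_a D \<mu> u' ?ph + form_a D \<mu> ?uh p') = 0"
    using truth_solution(3)[OF \<mu> V'(2)] truth_solution(4)[OF \<mu> V'(1)] forms(6)[OF \<mu>, of u' ?uh] by simp
  finally have R: "(R \<longlongrightarrow> 0) (seg i \<mu>)" .
  let ?q = "\<lambda>g t. (1 / t) *\<^sub>R (g (?\<nu> t) - g (?\<nu> 0)) :: real"
  have quot: "(?q g \<longlongrightarrow> pd D g i \<mu>) (seg i \<mu>)" if "box_C1 (mu_lo D) (mu_hi D) g" for g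
    by (rule box_C1_D(3)[OF that \<mu> i, unfolded has_vector_derivative_iff_quotient])
  have "((\<lambda>t. ?q (Theta D) t + ?q (\<lambda>\<nu>. form_j D \<nu> ?uh) t + ?q (\<lambda>\<nu>. form_k D \<nu> ?uh ?uh) t
      + ?q (\<lambda>\<nu>. form_l D \<nu> ?ph) t - ?q (\<lambda>\<nu>. form_a D \<nu> ?uh ?ph) t + R t)
    \<longlongrightarrow> pd_lagrangian i ?uh ?ph \<mu> + 0) (seg i \<mu>)"
    unfolding pd_lagrangian_def by (intro tendsto_add tendsto_diff quot forms_C1 R)
  then have L: "((\<lambda>t. ?q (Theta D) t + ?q (\<lambda>\<nu>. form_j D \<nu> ?uh) t + ?q (\<lambda>\<nu>. form_k D \<nu> ?uh ?uh) t
      + ?q (\<lambda>\<nu>. form_l D \<nu> ?ph) t - ?q (\<lambda>\<nu>. form_a D \<nu> ?uh ?ph) t + R t)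
    \<longlongrightarrow> pd_lagrangian i ?uh ?ph \<mu>) (seg i \<mu>)" by simp
  show ?thesis
    unfolding has_vector_derivative_iff_quotient
  proof (rule Lim_transform_eventually[OF L])
    show "eventually (\<lambda>t. ?q (Theta D) t + ?q (\<lambda>\<nu>. form_j D \<nu> ?uh) t + ?q (\<lambda>\<nu>. form_k D \<nu> ?uh ?uh) t
      + ?q (\<lambda>\<nu>. form_l D \<nu> ?ph) t - ?q (\<lambda>\<nu>. form_a D \<nu> ?uh ?ph) t + R t =
      (1 / t) *\<^sub>R (J_r D M (?\<nu> t) - J_r D M (?\<nu> 0))) (seg i \<mu>)"
      using evf
    proof eventually_elim
      case (elim t)
      have *: "form_j D (?\<nu> t) (U t) = (1 / t) * (form_j D (?\<nu> t) (?u t) - form_j D (?\<nu> t) ?uh)"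
        "form_k D (?\<nu> t) (U t) (?u t) = (1 / t) * (form_k D (?\<nu> t) (?u t) (?u t) - form_k D (?\<nu> t) ?uh (?u t))"
        "form_k D (?\<nu> t) ?uh (U t) = (1 / t) * (form_k D (?\<nu> t) ?uh (?u t) - form_k D (?\<nu> t) ?uh ?uh)"
        "form_l D (?\<nu> t) (P t) = (1 / t) * (form_l D (?\<nu> t) (?p t) - form_l D (?\<nu> t) ?ph)"
        "form_a D (?\<nu> t) (U t) (?p t) = (1 / t) * (form_a D (?\<nu> t) (?u t) (?p t) - form_a D (?\<nu> t) ?uh (?p t))"
        "form_a D (?\<nu> t) ?uh (P t) = (1 / t) * (form_a D (?\<nu> t) ?uh (?p t) - form_a D (?\<nu> t) ?uh ?ph)"
        unfolding U_def P_def using u0 p0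
        by (simp_all only: scale_zero_left add_0_right real_scaleR_def
            linear_scale[OF elim(3)] linear_scale[OF elim(4)] linear_diff[OF elim(3)] linear_diff[OF elim(4)]
            linear_scale[OF bilinear_lin(1)[OF elim(1)]] linear_diff[OF bilinear_lin(1)[OF elim(1)]]
            linear_scale[OF bilinear_lin(2)[OF elim(1)]] linear_diff[OF bilinear_lin(2)[OF elim(1)]]
            linear_scale[OF bilinear_lin(1)[OF elim(2)]] linear_diff[OF bilinear_lin(1)[OF elim(2)]]
            linear_scale[OF bilinear_lin(2)[OF elim(2)]] linear_diff[OF bilinear_lin(2)[OF elim(2)]])
      show ?case
        unfolding R_def * J_r_def cost_def r_pr_def using u0 p0
        by (simp add: algebra_simps)
    qed
  qed
qed

lemma J_h_has_vector_derivative: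
  assumes \<mu>: "\<mu> \<in> Pset D" and i: "mu_lo D $ i \<noteq> mu_hi D $ i"
  shows "((\<lambda>t. J_h D (\<mu> + t *\<^sub>R axis i 1)) has_vector_derivative
    pd_lagrangian i (u_h D \<mu>) (p_h D \<mu>) \<mu>) (seg i \<mu>)"
  by (subst has_vector_derivative_axis_seg_cong[OF J_h_eq \<mu>])
     (use J_r_has_vector_derivative[OF model_full \<mu> i] in \<open>simp_all add: u_h_eq p_h_eq\<close>)

lemma nabla_J_r_eq:
  assumes M: "model M" and \<mu>: "\<mu> \<in> Pset D" and "u_h D \<mu> \<in> fst M" "p_h D \<mu> \<in> snd M"
  shows "nabla D (J_r D M) \<mu> = nabla D (J_h D) \<mu>"
proof -
  have "pd D (J_r D M) i \<mu> = pd D (J_h D) i \<mu>" for i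
  proof (cases "mu_lo D $ i = mu_hi D $ i")
    case False
    then show ?thesis
      using pdiff_eqI[OF \<mu> False J_r_has_vector_derivative[OF M \<mu> False reproduces_truth[OF assms]]]
        pdiff_eqI[OF \<mu> False J_h_has_vector_derivative[OF \<mu> False]] by simp
  qed (simp add: pdiff_degenerate)
  then show ?thesis by (simp add: grad_def)
qed

text \<open>On nondegenerate directions the gradient has the closed form
  \<open>pd_lagrangian\<close> at the truth states. This is continuous because the truth states and
  the partial derivatives of the forms are.\<close>

lemma continuous_on_nabla_J_h: "continuous_on (Pset D) (nabla D (J_h D))"
proof -
  have "continuous_on (Pset D) (pd D (J_h D) i)" for i
  proof (cases "mu_lo D $ i = mu_hi D $ i")
    case False
    have eq: "pd D (J_h D) i \<mu> = pd_lagrangian i (u_h D \<mu>) (p_h D \<mu>) \<mu>" if "\<mu> \<in> Pset D" for \<mu>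
      by (rule pdiff_eqI[OF that False J_h_has_vector_derivative[OF that False]])
    have "continuous_on (Pset D) (\<lambda>\<mu>. pd_lagrangian i (u_h D \<mu>) (p_h D \<mu>) \<mu>)"
      unfolding continuous_on_def
    proof
      fix \<mu> assume \<mu>: "\<mu> \<in> Pset D"
      have t: "((\<lambda>\<nu>. \<nu>) \<longlongrightarrow> \<mu>) (at \<mu> within Pset D)" "eventually (\<lambda>\<nu>. \<nu> \<in> Pset D) (at \<mu> within Pset D)"
        by (auto simp: eventually_at_filter)
      have uh: "((\<lambda>\<nu>. u_h D \<nu>) \<longlongrightarrow> u_h D \<mu>) (at \<mu> within Pset D)"
        and ph: "((\<lambda>\<nu>. p_h D \<nu>) \<longlongrightarrow> p_h D \<mu>) (at \<mu> within Pset D)"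
        unfolding u_h_eq p_h_eq
        by (rule u_r_tendsto[OF model_full t(1) \<mu> t(2)] p_r_tendsto[OF model_full t(1) \<mu> t(2)])+
      have ev: "eventually (\<lambda>\<nu>. u_h D \<nu> \<in> Vh D) (at \<mu> within Pset D)"
        "eventually (\<lambda>\<nu>. p_h D \<nu> \<in> Vh D) (at \<mu> within Pset D)"
        by (rule eventually_mono[OF t(2)], rule truth_solution, assumption)+
      have evf: "eventually (\<lambda>\<nu>. bilinear (\<lambda>u v. pd D (\<lambda>\<mu>. form_a D \<mu> u v) i \<nu>)) (at \<mu> within Pset D)"
        "eventually (\<lambda>\<nu>. bilinear (\<lambda>u v. pd D (\<lambda>\<mu>. form_k D \<mu> u v) i \<nu>)) (at \<mu> within Pset D)"
        "eventually (\<lambda>\<nu>. linear (\<lambda>v. pd D (\<lambda>\<mu>. form_l D \<mu> v) i \<nu>)) (at \<mu> within Pset D)"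
        "eventually (\<lambda>\<nu>. linear (\<lambda>v. pd D (\<lambda>\<mu>. form_j D \<mu> v) i \<nu>)) (at \<mu> within Pset D)"
        by (rule eventually_mono[OF t(2)], rule pd_forms, assumption)+
      have lims: "((\<lambda>\<nu>. pd D g i \<nu>) \<longlongrightarrow> pd D g i \<mu>) (at \<mu> within Pset D)"
        if "box_C1 (mu_lo D) (mu_hi D) g" for g
        using box_C1_D(2)[OF that, of i] \<mu> unfolding continuous_on_def by auto
      show "((\<lambda>\<nu>. pd_lagrangian i (u_h D \<nu>) (p_h D \<nu>) \<nu>) \<longlongrightarrow> pd_lagrangian i (u_h D \<mu>) (p_h D \<mu>) \<mu>)
          (at \<mu> within Pset D)"
        unfolding pd_lagrangian_def
        by (intro tendsto_add tendsto_diff lims forms_C1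
            tendsto_linear_fin_dim[OF fin_dim_Vh _ ev(1) uh evf(4)]
            tendsto_linear_fin_dim[OF fin_dim_Vh _ ev(2) ph evf(3)]
            tendsto_bilinear_fin_dim[OF fin_dim_Vh _ _ ev(1) uh ev(1) uh evf(2)]
            tendsto_bilinear_fin_dim[OF fin_dim_Vh _ _ ev(1) uh ev(2) ph evf(1)]
            truth_solution \<mu> pd_forms)
    qed
    then show ?thesis using eq by (simp cong: continuous_on_cong)
  qed (simp add: pdiff_degenerate)
  then show ?thesis unfolding grad_def by (intro continuous_on_vec_lambda)
qed

text \<open>Serves the Taylor variant: the sensitivities it adds must not lead out of
  \<open>Vh D\<close>, or the reduced spaces could grow without bound.\<close>

lemma pd_truth_in_Vh:
  assumes "\<mu> \<in> Pset D"
  shows "pd D (u_h D) i \<mu> \<in> Vh D" "pd D (p_h D) i \<mu> \<in> Vh D"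
proof -
  have sub: "subspace (Vh D)" by (rule fin_dim_subspace[OF fin_dim_Vh])
  show "pd D (u_h D) i \<mu> \<in> Vh D"
  proof (cases "mu_lo D $ i = mu_hi D $ i")
    case True then show ?thesis using sub by (simp add: pdiff_degenerate subspace_0)
  next
    case False
    then show ?thesis
      using u_r_has_vector_derivative[OF model_full assms False] pdiff_eqI[OF assms False]
      unfolding u_h_eq by fastforce
  qed
  show "pd D (p_h D) i \<mu> \<in> Vh D"
  proof (cases "mu_lo D $ i = mu_hi D $ i")
    case True then show ?thesis using sub by (simp add: pdiff_degenerate subspace_0)
  next
    case False
    then show ?thesis
      using p_r_has_vector_derivative[OF model_full assms False] pdiff_eqI[OF assms False]
      unfolding p_h_eq by fastforce
  qed
qed

end

section \<open>The trust-region iteration\<close>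

text \<open>The three ways of accepting collapse to this alternative, and it is all that is used of
  them. In each case the radius in the skip flag is the one passed on to the next iteration.\<close>

lemma accept_cases:
  assumes "accept D A M \<delta> \<mu> c t \<delta>' M'"
  shows "M' = M \<and> Skip D A M t \<delta>' \<or> M' = rb_update D (taylor A) M t"
  using assms by cases (auto split: if_splits)

lemma reject_cases:
  assumes "reject D A M \<delta> sp \<mu> c t \<delta>' M'"
  shows "\<delta>' = beta1 A * \<delta>" "M' = M \<or> M' = rb_update D (taylor A) M t"
  using assms by (cases, auto split: if_splits)+

lemma crit_tendsto:
  fixes lo hi :: "real^'p::finite"
  assumes "\<And>i. lo $ i \<le> hi $ i" "continuous_on (cbox lo hi) (grad lo hi f)"
    and "(x \<longlongrightarrow> x0) F" "x0 \<in> cbox lo hi" "eventually (\<lambda>s. x s \<in> cbox lo hi) F"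
  shows "((\<lambda>s. crit lo hi f (x s)) \<longlongrightarrow> crit lo hi f x0) F"
proof -
  have g: "((\<lambda>s. grad lo hi f (x s)) \<longlongrightarrow> grad lo hi f x0) F"
    by (rule continuous_on_tendsto_compose[OF assms(2-5)])
  have "isCont (clamp lo hi) z" for z
    using clamp_continuous_at[of lo hi "\<lambda>x. x" z] by simp
  then show ?thesis
    unfolding crit_def by (intro tendsto_norm tendsto_diff assms(3) isCont_tendsto_compose[of _ "clamp lo hi"] g)
qed

lemma continuous_on_grad:
  fixes lo hi :: "real^'p::finite"
  assumes "box_C1 lo hi f"
  shows "continuous_on (cbox lo hi) (grad lo hi f)"
  unfolding grad_def by (intro continuous_on_vec_lambda box_C1_D(2)[OF assms])

context smooth_problem
begin

section \<open>Updates of the model and the backtracking line search\<close>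

lemma ddiff_truth_in_Vh:
  assumes "\<mu> \<in> Pset D"
  shows "ddiff (mu_lo D) (mu_hi D) (u_h D) \<eta> \<mu> \<in> Vh D" "ddiff (mu_lo D) (mu_hi D) (p_h D) \<eta> \<mu> \<in> Vh D"
  unfolding ddiff_def using pd_truth_in_Vh[OF assms] fin_dim_subspace[OF fin_dim_Vh]
  by (auto intro!: subspace_sum subspace_scale)

lemma fin_dim_span_Vh:
  assumes "X \<subseteq> Vh D"
  shows "fin_dim (span X)" "span X \<subseteq> Vh D"
proof -
  show "span X \<subseteq> Vh D" using span_minimal[OF assms fin_dim_subspace[OF fin_dim_Vh]] .
  then show "fin_dim (span X)" by (rule fin_dim_subset[OF fin_dim_Vh subspace_span])
qed

lemma model_init:
  assumes "\<mu> \<in> Pset D"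
  shows "model (rb_init D \<mu>)"
  unfolding model_def rb_init_def using fin_dim_span_Vh truth_solution[OF assms] by simp

lemma model_update:
  assumes "model M" "\<mu> \<in> Pset D"
  shows "model (rb_update D b M \<mu>)"
proof -
  have "fst M \<union> {u_h D \<mu>} \<union> (if b then {ddiff (mu_lo D) (mu_hi D) (u_h D) \<eta> \<mu>} else {}) \<subseteq> Vh D"
    "snd M \<union> {p_h D \<mu>} \<union> (if b then {ddiff (mu_lo D) (mu_hi D) (p_h D) \<eta> \<mu>} else {}) \<subseteq> Vh D" for \<eta>
    using modelD[OF assms(1)] truth_solution[OF assms(2)] ddiff_truth_in_Vh[OF assms(2)] by auto
  from fin_dim_span_Vh[OF this(1)] fin_dim_span_Vh[OF this(2)] show ?thesis
    unfolding model_def rb_update_def Let_def by simp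
qed

lemma rb_update_superset:
  "fst M \<subseteq> fst (rb_update D b M \<mu>)" "snd M \<subseteq> snd (rb_update D b M \<mu>)"
  "u_h D \<mu> \<in> fst (rb_update D b M \<mu>)" "p_h D \<mu> \<in> snd (rb_update D b M \<mu>)"
  unfolding rb_update_def Let_def by (auto intro: span_base)

text \<open>Both summands of \<open>Delta_J\<close> contain the factor \<open>Delta_pr\<close>, and
  the primal residual of the reproduced state vanishes on \<open>Vh D\<close>.\<close>

lemma q_r_eq_0:
  assumes "model M" "\<mu> \<in> Pset D" "u_h D \<mu> \<in> fst M" "p_h D \<mu> \<in> snd M"
  shows "q_r D M \<mu> = 0"
proof -
  have ne: "Vh D \<noteq> {}" using truth_solution(1)[OF assms(2)] by auto
  have "dual_norm (Vh D) (r_pr D \<mu> (u_h D \<mu>)) = (SUP v\<in>Vh D. 0)"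
    unfolding dual_norm_def by (rule SUP_cong) (simp_all add: r_pr_def truth_solution(3)[OF assms(2)])
  also have "\<dots> = 0" using ne by simp
  finally show ?thesis
    unfolding q_r_def Delta_J_def Delta_pr_def reproduces_truth(1)[OF assms] by simp
qed

lemma ls_point_in_Pset: "ls_point D A \<mu> d j \<in> Pset D"
  unfolding ls_point_def by (rule clamp_in_cbox[OF box_le])

lemma line_search_in_Pset: "line_search D A M \<delta> \<mu> d \<nu> \<Longrightarrow> \<nu> \<in> Pset D"
  unfolding line_search_def using ls_point_in_Pset by blast

lemma proj_newton_in_Pset: "proj_newton D A M \<delta> \<mu> \<nu> \<Longrightarrow> \<mu> \<in> Pset D \<Longrightarrow> \<nu> \<in> Pset D"
  by (induction rule: proj_newton.induct) (auto intro: line_search_in_Pset)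

lemma norm_ls_point_le:
  assumes "\<mu> \<in> Pset D" "kappa A > 0"
  shows "norm (ls_point D A \<mu> d j - \<mu>) \<le> kappa A ^ j * norm d"
proof -
  have "dist (ls_point D A \<mu> d j) (proj D \<mu>) \<le> dist (\<mu> + kappa A ^ j *\<^sub>R d) \<mu>"
    unfolding ls_point_def by (rule dist_clamps_le_dist_args)
  then show ?thesis using assms by (simp add: dist_norm)
qed

lemma kappa_arm_bounds: "0 < kappa_arm" "kappa_arm < 1"
  unfolding kappa_arm_def by simp_all

text \<open>Every step factor below \<open>(1 - kappa_arm) / L\<close> and \<open>\<eta> / G\<close>
  passes both tests: the first threshold secures sufficient decrease, the second keeps the point in
  the ball where the trust-region condition is assumed. The smallest accepted exponent therefore
  cannot be large, and \<open>s\<close> bounds its step factor from below.\<close>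

lemma AGC_backtracking:
  fixes M :: "'v rb"
  assumes agc: "is_AGC D A M \<delta> \<mu> \<nu>" and \<mu>: "\<mu> \<in> Pset D" and \<kappa>: "0 < kappa A" "kappa A < 1"
    and C2: "C2_loclip_on (Pset D) (J_r D M)" and L: "L > 0"
    and lip: "\<forall>\<mu>\<in>Pset D. \<forall>\<nu>\<in>Pset D. norm (nabla D (J_r D M) \<mu> - nabla D (J_r D M) \<nu>) \<le> L * norm (\<mu> - \<nu>)"
    and G: "norm (nabla D (J_r D M) \<mu>) < G"
    and \<eta>: "\<eta> > 0" "\<And>\<nu>. \<nu> \<in> Pset D \<Longrightarrow> norm (\<nu> - \<mu>) < \<eta> \<Longrightarrow> q_r D M \<nu> \<le> \<delta>"
    and s: "s \<le> 1" "s \<le> kappa A * ((1 - kappa_arm) / L)" "s \<le> kappa A * (\<eta> / G)"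
  shows "J_r D M \<nu> - J_r D M \<mu> \<le> - kappa_arm * (norm (\<nu> - \<mu>))\<^sup>2"
    and "s * g_r D M \<mu> \<le> norm (\<nu> - \<mu>)"
proof -
  let ?g = "nabla D (J_r D M) \<mu>"
  obtain j where j: "arm_tr D A M \<delta> \<mu> (- ?g) j" "\<And>i. i < j \<Longrightarrow> \<not> arm_tr D A M \<delta> \<mu> (- ?g) i"
      "\<nu> = ls_point D A \<mu> (- ?g) j"
    using agc unfolding is_AGC_def line_search_def by blast
  have pos: "kappa A ^ i > 0" and le1: "kappa A ^ i \<le> 1" for i
    using \<kappa> by (auto intro: power_le_one)
  have ls: "ls_point D A \<mu> (- ?g) i = proj D (\<mu> - kappa A ^ i *\<^sub>R ?g)" for i
    unfolding ls_point_def by simp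
  have Gpos: "G > 0" using G norm_ge_zero[of ?g] by linarith
  have arm: "arm_tr D A M \<delta> \<mu> (- ?g) i"
    if i: "kappa A ^ i \<le> (1 - kappa_arm) / L" "kappa A ^ i \<le> \<eta> / G" for i
    unfolding arm_tr_def
  proof
    show "J_r D M (ls_point D A \<mu> (- ?g) i) - J_r D M \<mu>
       \<le> - (kappa_arm / kappa A ^ i) * (norm (ls_point D A \<mu> (- ?g) i - \<mu>))\<^sup>2"
      unfolding ls
      by (rule projected_gradient_armijo[OF box_le C2 lip \<mu> pos])
         (use i L in \<open>simp_all add: pos_le_divide_eq\<close>)
    have "norm (ls_point D A \<mu> (- ?g) i - \<mu>) \<le> kappa A ^ i * norm ?g"
      using norm_ls_point_le[OF \<mu> \<kappa>(1), of "- ?g" i] by simp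
    \<comment> \<open>Strict since \<open>G\<close> exceeds the gradient norm strictly; the ball of
      radius \<open>\<eta>\<close> is open.\<close>
    also have "\<dots> < kappa A ^ i * G" using G pos by (intro mult_strict_left_mono)
    also have "\<dots> \<le> \<eta>" using i(2) Gpos by (simp add: pos_le_divide_eq)
    finally show "q_r D M (ls_point D A \<mu> (- ?g) i) \<le> \<delta>"
      by (intro \<eta>(2) ls_point_in_Pset)
  qed
  \<comment> \<open>Either no backtracking took place and the factor is \<open>1\<close>, or the
    preceding exponent failed and so exceeded one of the thresholds; the extra
    \<open>kappa A\<close> in the bounds on \<open>s\<close> accounts for the one further
    reduction.\<close>
  have sj: "s \<le> kappa A ^ j"
  proof (cases j)
    case (Suc i)
    then have "\<not> arm_tr D A M \<delta> \<mu> (- ?g) i" using j(2) by simp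
    then have "kappa A ^ i > (1 - kappa_arm) / L \<or> kappa A ^ i > \<eta> / G" using arm[of i] not_le by blast
    then show ?thesis
    proof
      assume "kappa A ^ i > (1 - kappa_arm) / L"
      then have "kappa A * ((1 - kappa_arm) / L) \<le> kappa A * kappa A ^ i" using \<kappa>(1) by (intro mult_left_mono) auto
      then show ?thesis using s(2) Suc by simp
    next
      assume "kappa A ^ i > \<eta> / G"
      then have "kappa A * (\<eta> / G) \<le> kappa A * kappa A ^ i" using \<kappa>(1) by (intro mult_left_mono) auto
      then show ?thesis using s(3) Suc by simp
    qed
  qed (use s(1) in simp)
  have "kappa_arm \<le> kappa_arm / kappa A ^ j"
    using pos[of j] le1[of j] kappa_arm_bounds by (simp add: pos_le_divide_eq mult_left_le)
  then have "kappa_arm * (norm (\<nu> - \<mu>))\<^sup>2 \<le> kappa_arm / kappa A ^ j * (norm (\<nu> - \<mu>))\<^sup>2"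
    by (intro mult_right_mono) auto
  then show "J_r D M \<nu> - J_r D M \<mu> \<le> - kappa_arm * (norm (\<nu> - \<mu>))\<^sup>2"
    using j(1) unfolding arm_tr_def j(3)[symmetric] by linarith
  have "s * g_r D M \<mu> \<le> kappa A ^ j * g_r D M \<mu>"
    using sj by (intro mult_right_mono) (auto simp: g_r_def crit_def)
  also have "\<dots> \<le> norm (\<nu> - \<mu>)"
    unfolding g_r_def crit_def j(3) ls by (rule norm_clamp_step_ge[OF box_le \<mu> pos le1])
  finally show "s * g_r D M \<mu> \<le> norm (\<nu> - \<mu>)" .
qed

end

locale trrb = smooth_problem D
  for D :: "('v::{real_inner,complete_space}, 'p::finite) problem" +
  fixes A :: "'p alg_par"
    and mu agc :: "nat \<Rightarrow> real^'p"
    and nrej :: "nat \<Rightarrow> nat"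
    and rad :: "nat \<Rightarrow> nat \<Rightarrow> real"
    and rb :: "nat \<Rightarrow> nat \<Rightarrow> 'v rb"
    and trial :: "nat \<Rightarrow> nat \<Rightarrow> real^'p"
  assumes par: "wf_par D A" and run: "trrb_run D A mu agc nrej rad rb trial"
begin

section \<open>Invariants along a run\<close>

lemma run_step:
  "is_AGC D A (rb k 0) (rad k 0) (mu k) (agc k)"
  "i \<le> nrej k \<Longrightarrow> proj_newton D A (rb k i) (rad k i) (agc k) (trial k i)"
  "i < nrej k \<Longrightarrow> reject D A (rb k i) (rad k i) (skip_prev D A mu nrej rad rb k)
      (mu k) (agc k) (trial k i) (rad k (Suc i)) (rb k (Suc i))"
  "accept D A (rb k (nrej k)) (rad k (nrej k)) (mu k) (agc k) (mu (Suc k)) (rad (Suc k) 0) (rb (Suc k) 0)"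
  "mu (Suc k) = trial k (nrej k)"
  using run unfolding trrb_run_def by auto

lemma agc_in_Pset: "agc k \<in> Pset D"
  using run_step(1)[of k] line_search_in_Pset unfolding is_AGC_def by blast

lemma trial_in_Pset: "i \<le> nrej k \<Longrightarrow> trial k i \<in> Pset D"
  using proj_newton_in_Pset[OF run_step(2) agc_in_Pset] .

lemma mu_in_Pset: "mu k \<in> Pset D"
proof (cases k)
  case 0
  then show ?thesis using run par unfolding trrb_run_def wf_par_def by simp
next
  case (Suc m)
  then show ?thesis using trial_in_Pset[of "nrej m" m] run_step(5)[of m] by simp
qed

definition sub_model :: "'v rb \<Rightarrow> 'v rb \<Rightarrow> bool" where
  "sub_model M M' \<longleftrightarrow> fst M \<subseteq> fst M' \<and> snd M \<subseteq> snd M'"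

lemma sub_model_update: "sub_model M (rb_update D b M \<mu>)"
  unfolding sub_model_def by (intro conjI rb_update_superset)

lemma sub_model_refl: "sub_model M M"
  unfolding sub_model_def by simp

lemma sub_model_trans: "sub_model M M' \<Longrightarrow> sub_model M' M'' \<Longrightarrow> sub_model M M''"
  unfolding sub_model_def by auto

lemma reject_model:
  assumes "i < nrej k"
  shows "sub_model (rb k i) (rb k (Suc i))" "model (rb k i) \<Longrightarrow> model (rb k (Suc i))"
  using reject_cases(2)[OF run_step(3)[OF assms]] model_update[OF _ trial_in_Pset, of "rb k i" i k] assms
    by (auto intro: sub_model_update sub_model_refl)

lemma accept_model:
  "sub_model (rb k (nrej k)) (rb (Suc k) 0)" "model (rb k (nrej k)) \<Longrightarrow> model (rb (Suc k) 0)"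
  using accept_cases[OF run_step(4)[of k]] model_update[OF _ mu_in_Pset, of "rb k (nrej k)" _ "Suc k"]
    by (auto intro: sub_model_update sub_model_refl)

lemma model_rb_attempt: "model (rb k 0) \<Longrightarrow> i \<le> nrej k \<Longrightarrow> model (rb k i)"
  by (induction i) (auto intro: reject_model)

lemma model_rb: "i \<le> nrej k \<Longrightarrow> model (rb k i)"
proof -
  have "model (rb k 0)"
  proof (induction k)
    case 0
    show ?case using run par model_init unfolding trrb_run_def wf_par_def by simp
  qed (use accept_model model_rb_attempt in blast)
  then show "i \<le> nrej k \<Longrightarrow> model (rb k i)" by (rule model_rb_attempt)
qed

lemma sub_model_first: "i \<le> nrej k \<Longrightarrow> sub_model (rb k 0) (rb k i)"
proof (induction i)
  case (Suc i)
  then show ?case using reject_model(1)[of i k] sub_model_trans by (meson Suc_le_lessD less_imp_le)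
qed (simp add: sub_model_def)

lemma sub_model_next: "i \<le> nrej k \<Longrightarrow> sub_model (rb k i) (rb (Suc k) 0)"
proof (induction rule: inc_induct)
  case base
  show ?case by (rule accept_model)
next
  case (step i)
  then show ?case using reject_model(1)[of i k] sub_model_trans by blast
qed

text \<open>Every update enlarges spaces inside the finite-dimensional \<open>Vh D\<close>.\<close>

lemma rb_eventually_constant:
  obtains K where "\<And>k i. K \<le> k \<Longrightarrow> i \<le> nrej k \<Longrightarrow> rb k i = rb K 0"
proof -
  have m: "model (rb k 0)" for k by (rule model_rb) simp
  have mono: "sub_model (rb k 0) (rb (Suc k) 0)" for k by (rule sub_model_next) simp
  obtain K1 where K1: "\<And>k. K1 \<le> k \<Longrightarrow> fst (rb k 0) = fst (rb K1 0)"
    using fin_dim_chain_stabilises[OF fin_dim_Vh, of "\<lambda>k. fst (rb k 0)"]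
      modelD(1,3)[OF m] fin_dim_subspace mono unfolding sub_model_def by metis
  obtain K2 where K2: "\<And>k. K2 \<le> k \<Longrightarrow> snd (rb k 0) = snd (rb K2 0)"
    using fin_dim_chain_stabilises[OF fin_dim_Vh, of "\<lambda>k. snd (rb k 0)"]
      modelD(2,4)[OF m] fin_dim_subspace mono unfolding sub_model_def by metis
  let ?K = "max K1 K2"
  have eq: "rb k 0 = rb ?K 0" if "?K \<le> k" for k
    using K1[of k] K2[of k] K1[of ?K] K2[of ?K] that by (simp add: prod_eq_iff)
  \<comment> \<open>The models of the intermediate attempts are squeezed between the first models of
    iterations \<open>k\<close> and \<open>Suc k\<close>, which already agree.\<close>
  have "rb k i = rb ?K 0" if k: "?K \<le> k" and i: "i \<le> nrej k" for k i
  proof -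
    have "sub_model (rb ?K 0) (rb k i)" using sub_model_first[OF i] eq[OF k] by simp
    moreover have "sub_model (rb k i) (rb ?K 0)"
      using sub_model_next[OF i] eq[of "Suc k"] k by simp
    ultimately show ?thesis unfolding sub_model_def by (intro prod_eqI subset_antisym) auto
  qed
  then show ?thesis by (rule that)
qed

lemma rad_attempt: "i \<le> nrej k \<Longrightarrow> rad k i = beta1 A ^ i * rad k 0"
  by (induction i) (simp_all add: reject_cases(1)[OF run_step(3)])

text \<open>(A5) bounds the radius of the accepted attempt, while the AGC point is computed with
  that of attempt \<open>0\<close>. Rejections only shrink the radius, so the bound carries over
  backwards.\<close>

lemma rad_first_gt:
  assumes "\<tau> > 0" "rad k (nrej k) > \<tau>"
  shows "rad k 0 > \<tau>"
proof -
  have b: "0 < beta1 A" "beta1 A < 1" using par unfolding wf_par_def by auto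
  have eq: "rad k (nrej k) = beta1 A ^ nrej k * rad k 0" by (rule rad_attempt) simp
  have "rad k 0 > 0"
    using assms b eq zero_less_mult_pos[of "beta1 A ^ nrej k" "rad k 0"] by simp
  then have "beta1 A ^ nrej k * rad k 0 \<le> 1 * rad k 0"
    using b by (intro mult_right_mono power_le_one) auto
  then show ?thesis using eq assms(2) by simp
qed

text \<open>Model and radius here are those that determine the next AGC point. Since
  \<open>beta3 A < 1\<close>, the iterate lies strictly inside its trust region.\<close>

lemma q_r_first_le:
  assumes "rad (Suc k) 0 > 0"
  shows "q_r D (rb (Suc k) 0) (mu (Suc k)) \<le> beta3 A * rad (Suc k) 0"
  using accept_cases[OF run_step(4)[of k]]
proof
  assume "rb (Suc k) 0 = rb k (nrej k) \<and> Skip D A (rb k (nrej k)) (mu (Suc k)) (rad (Suc k) 0)"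
  then show ?thesis unfolding Skip_def by simp
next
  assume "rb (Suc k) 0 = rb_update D (taylor A) (rb k (nrej k)) (mu (Suc k))"
  then have "q_r D (rb (Suc k) 0) (mu (Suc k)) = 0"
    using model_rb[of 0 "Suc k"] mu_in_Pset rb_update_superset(3,4) by (intro q_r_eq_0) auto
  then show ?thesis using assms par unfolding wf_par_def by simp
qed

lemma g_h_le_g_r:
  assumes const: "rb (Suc k) 0 = M" "rb k (nrej k) = M"
  shows "g_h D (mu (Suc k)) \<le> (1 + tau_g A) * g_r D M (mu (Suc k))"
proof -
  have tau: "tau_g A > 0" using par unfolding wf_par_def by auto
  have gr: "g_r D M (mu (Suc k)) \<ge> 0" unfolding g_r_def crit_def by simp
  show ?thesis
    using accept_cases[OF run_step(4)[of k]] unfolding const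
  proof
    assume "M = M \<and> Skip D A M (mu (Suc k)) (rad (Suc k) 0)"
    \<comment> \<open>Excluding a zero denominator matters: with \<open>x / 0 = 0\<close> the
      quotient bound would say nothing about \<open>g_h\<close> when \<open>g_r\<close>
      vanishes.\<close>
    then have "g_r D M (mu (Suc k)) \<noteq> 0"
      "\<bar>g_h D (mu (Suc k)) - g_r D M (mu (Suc k))\<bar> / g_r D M (mu (Suc k)) \<le> tau_g A"
      unfolding Skip_def by auto
    then have "\<bar>g_h D (mu (Suc k)) - g_r D M (mu (Suc k))\<bar> \<le> tau_g A * g_r D M (mu (Suc k))"
      using gr by (simp add: pos_divide_le_eq)
    then show ?thesis by (simp add: algebra_simps abs_le_iff)
  next
    \<comment> \<open>The update has left the model unchanged, so the truth states at the iterate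
      already belong to \<open>M\<close> and the gradients of \<open>J_r\<close> and
      \<open>J_h\<close> coincide there.\<close>
    assume eq: "M = rb_update D (taylor A) M (mu (Suc k))"
    have "model M" using model_rb[of 0 "Suc k"] const by simp
    then have "nabla D (J_r D M) (mu (Suc k)) = nabla D (J_h D) (mu (Suc k))"
      using rb_update_superset(3,4)[of "mu (Suc k)" "taylor A" M] eq mu_in_Pset by (intro nabla_J_r_eq) auto
    then have "g_h D (mu (Suc k)) = g_r D M (mu (Suc k))" unfolding g_h_def g_r_def crit_def by simp
    then show ?thesis using gr tau by (simp add: algebra_simps)
  qed
qed

end

theorem theorem3p8:
  fixes D :: "('v::{real_inner,complete_space}, 'p::finite) problem"
    and A :: "'p alg_par"
    and mu agc :: "nat \<Rightarrow> real^'p"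
    and nrej :: "nat \<Rightarrow> nat"
    and rad :: "nat \<Rightarrow> nat \<Rightarrow> real"
    and rb :: "nat \<Rightarrow> nat \<Rightarrow> 'v rb"
    and trial :: "nat \<Rightarrow> nat \<Rightarrow> real^'p"
    and eps_truth tau_mac C_L :: real
    and mubar :: "real^'p"
  assumes problem: "wf_problem D"
    and parameters: "wf_par D A"
    and run: "trrb_run D A mu agc nrej rad rb trial"
    and A1_A2: "separable_smooth D"
    and A3: "truth_error_le D eps_truth"
    and A4: "\<forall>u. \<forall>\<mu>\<in>Pset D. cost D u \<mu> > 0"
    and A5: "tau_mac > 0"
            "\<forall>k. rad k (nrej k) > tau_mac \<and>
                 J_r D (rb (Suc k) 0) (mu (Suc k)) \<le> J_r D (rb k (nrej k)) (agc k)"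
    and A6: "C_L > 0"
            "\<forall>k. \<forall>i\<le>nrej k. \<forall>\<mu>\<in>Pset D. \<forall>\<nu>\<in>Pset D.
               norm (nabla D (J_r D (rb k i)) \<mu> - nabla D (J_r D (rb k i)) \<nu>)
                 \<le> C_L * norm (\<mu> - \<nu>)"
            "\<forall>k. \<forall>i\<le>nrej k. C2_loclip_on (Pset D) (J_r D (rb k i))"
    and A7: "\<forall>\<epsilon>>0. \<exists>\<eta>>0. \<forall>k. \<forall>i\<le>nrej k. \<forall>\<mu>\<in>Pset D. \<forall>\<nu>\<in>Pset D.
               norm (\<mu> - \<nu>) < \<eta> \<longrightarrow> \<bar>q_r D (rb k i) \<mu> - q_r D (rb k i) \<nu>\<bar> < \<epsilon>"
    and accumulation: "\<exists>r. strict_mono r \<and> (mu \<circ> r) \<longlonglongrightarrow> mubar"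
  shows "norm (mubar - proj D (mubar - nabla D (J_h D) mubar)) = 0"
proof -
  interpret trrb D A mu agc nrej rad rb trial
    by unfold_locales (rule problem A1_A2 parameters run)+
  obtain K where K: "\<And>k i. K \<le> k \<Longrightarrow> i \<le> nrej k \<Longrightarrow> rb k i = rb K 0"
    by (rule rb_eventually_constant) (rule that)
  define M where "M = rb K 0"
  let ?f = "J_r D M"
  have C2: "C2_loclip_on (Pset D) ?f" using A6(3) unfolding M_def by blast
  have lip: "\<forall>\<mu>\<in>Pset D. \<forall>\<nu>\<in>Pset D. norm (nabla D ?f \<mu> - nabla D ?f \<nu>) \<le> C_L * norm (\<mu> - \<nu>)"
    using A6(2) unfolding M_def by blast
  have C1: "box_C1 (mu_lo D) (mu_hi D) ?f" by (rule C2_loclip_imp_box_C1[OF C2])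
  have "bounded (nabla D ?f ` Pset D)"
    by (intro compact_imp_bounded compact_continuous_image continuous_on_grad C1 compact_cbox)
  then obtain G0 where G0: "\<And>\<mu>. \<mu> \<in> Pset D \<Longrightarrow> norm (nabla D ?f \<mu>) \<le> G0" "G0 > 0"
    unfolding bounded_pos by blast
  define G where "G = G0 + 1"
  have G: "norm (nabla D ?f \<mu>) < G" if "\<mu> \<in> Pset D" for \<mu> using G0(1)[OF that] unfolding G_def by simp
  have Gpos: "G > 0" using G0(2) unfolding G_def by simp
  have "bounded (?f ` Pset D)"
    by (intro compact_imp_bounded compact_continuous_image box_C1_D(1)[OF C1] compact_cbox)
  then obtain B where B: "\<And>\<mu>. \<mu> \<in> Pset D \<Longrightarrow> \<bar>?f \<mu>\<bar> \<le> B" unfolding bounded_real by blast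
  have par: "0 < kappa A" "kappa A < 1" "0 < beta3 A" "beta3 A < 1" "tau_g A > 0"
    using parameters unfolding wf_par_def by auto
  \<comment> \<open>The smallest possible gap between the bound \<open>beta3 A * rad\<close> on
    \<open>q_r\<close> at an iterate and the radius; it does not depend on the iteration.\<close>
  have "(1 - beta3 A) * tau_mac > 0" using par A5(1) by simp
  then obtain \<eta> where \<eta>: "\<eta> > 0" "\<And>\<mu> \<nu>. \<mu> \<in> Pset D \<Longrightarrow> \<nu> \<in> Pset D \<Longrightarrow> norm (\<mu> - \<nu>) < \<eta> \<Longrightarrow>
      \<bar>q_r D M \<mu> - q_r D M \<nu>\<bar> < (1 - beta3 A) * tau_mac"
    using A7[rule_format, of "(1 - beta3 A) * tau_mac"] unfolding M_def by blast
  define s where "s = Min {1, kappa A * ((1 - kappa_arm) / C_L), kappa A * (\<eta> / G)}"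
  have s: "s \<le> 1" "s \<le> kappa A * ((1 - kappa_arm) / C_L)" "s \<le> kappa A * (\<eta> / G)" "s > 0"
    unfolding s_def using par A6(1) \<eta>(1) Gpos kappa_arm_bounds by simp_all
  define x where "x n = mu (Suc (n + K))" for n
  define y where "y n = agc (Suc (n + K))" for n
  have xP: "x n \<in> Pset D" for n unfolding x_def by (rule mu_in_Pset)
  have step: "?f (y n) - ?f (x n) \<le> - kappa_arm * (norm (y n - x n))\<^sup>2 \<and> s * g_r D M (x n) \<le> norm (y n - x n)" for n
  proof -
    let ?k = "Suc (n + K)"
    have M: "rb ?k 0 = M" unfolding M_def by (rule K) simp_all
    have rad: "rad ?k 0 > tau_mac" using rad_first_gt A5 by blast
    have q0: "q_r D M (x n) \<le> beta3 A * rad ?k 0"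
      using q_r_first_le[of "n + K"] rad A5(1) M unfolding x_def by simp
    have q: "q_r D M \<nu> \<le> rad ?k 0" if "\<nu> \<in> Pset D" "norm (\<nu> - x n) < \<eta>" for \<nu>
    proof -
      have "q_r D M \<nu> \<le> beta3 A * rad ?k 0 + (1 - beta3 A) * tau_mac"
        using \<eta>(2)[OF that(1) xP that(2)] q0 by linarith
      also have "\<dots> \<le> beta3 A * rad ?k 0 + (1 - beta3 A) * rad ?k 0"
        using par rad by (intro add_left_mono mult_left_mono) auto
      finally show ?thesis by (simp add: algebra_simps)
    qed
    have agc: "is_AGC D A M (rad ?k 0) (x n) (y n)" using run_step(1)[of ?k] M unfolding x_def y_def by simp
    note bt = AGC_backtracking[OF agc xP par(1,2) C2 A6(1) lip G[OF xP] \<eta>(1) q s(1-3)]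
    show ?thesis using bt by blast
  qed
  \<comment> \<open>Here the two models compared in (A5) are both \<open>M\<close>, so successive
    inequalities can be chained.\<close>
  have decr: "?f (x (Suc n)) \<le> ?f (y n)" for n
  proof -
    have "rb (Suc (n + K)) (nrej (Suc (n + K))) = M" "rb (Suc (Suc (n + K))) 0 = M"
      unfolding M_def by (rule K; simp)+
    then show ?thesis using A5(2)[rule_format, of "Suc (n + K)"] unfolding x_def y_def by simp
  qed
  have sq: "kappa_arm * (norm (y n - x n))\<^sup>2 \<le> ?f (x n) - ?f (x (Suc n))" for n
    using step[of n] decr[of n] by linarith
  have "decseq (\<lambda>n. ?f (x n))"
  proof (rule decseq_SucI)
    fix n
    have "0 \<le> kappa_arm * (norm (y n - x n))\<^sup>2" using kappa_arm_bounds by simp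
    then show "?f (x (Suc n)) \<le> ?f (x n)" using sq[of n] by linarith
  qed
  moreover have "- B \<le> ?f (x n)" for n using B[OF xP[of n]] by linarith
  ultimately obtain l where l: "(\<lambda>n. ?f (x n)) \<longlonglongrightarrow> l"
    using decseq_convergent[of "\<lambda>n. ?f (x n)" "- B"] by blast
  have "(\<lambda>n. ?f (x n) - ?f (x (Suc n))) \<longlonglongrightarrow> l - l"
    by (intro tendsto_diff l LIMSEQ_Suc)
  then have quot: "(\<lambda>n. (?f (x n) - ?f (x (Suc n))) / kappa_arm) \<longlonglongrightarrow> 0"
    by (intro tendsto_divide_zero) simp
  have "(\<lambda>n. (norm (y n - x n))\<^sup>2) \<longlonglongrightarrow> 0"
    by (rule tendsto_sandwich[OF _ _ tendsto_const quot])
       (use sq kappa_arm_bounds in \<open>auto simp: pos_le_divide_eq mult.commute\<close>)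
  then have "(\<lambda>n. norm (y n - x n)) \<longlonglongrightarrow> 0"
    using tendsto_real_sqrt by fastforce
  then have lim: "(\<lambda>n. (1 + tau_g A) * (norm (y n - x n) / s)) \<longlonglongrightarrow> 0"
    by (intro tendsto_mult_right_zero tendsto_divide_zero)
  have g_le: "g_h D (x n) \<le> (1 + tau_g A) * (norm (y n - x n) / s)" for n
  proof -
    have "g_h D (x n) \<le> (1 + tau_g A) * g_r D M (x n)"
      unfolding x_def by (rule g_h_le_g_r) (unfold M_def, rule K; simp)+
    also have "\<dots> \<le> (1 + tau_g A) * (norm (y n - x n) / s)"
      using par(5) step[of n] s(4) by (intro mult_left_mono) (auto simp: pos_le_divide_eq mult.commute)
    finally show ?thesis .
  qed
  have g0: "(\<lambda>n. g_h D (x n)) \<longlonglongrightarrow> 0"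
    by (rule tendsto_sandwich[OF _ _ tendsto_const lim])
       (use g_le in \<open>auto simp: g_h_def crit_def\<close>)
  \<comment> \<open>The offset \<open>Suc K\<close> is removed, so the whole sequence
    \<open>g_h D (mu n)\<close> tends to \<open>0\<close>, and with it every subsequence.\<close>
  then have "(\<lambda>n. g_h D (mu (n + Suc K))) \<longlonglongrightarrow> 0" unfolding x_def by simp
  then have g0: "(\<lambda>n. g_h D (mu n)) \<longlonglongrightarrow> 0" by (rule LIMSEQ_offset)
  obtain r where r: "strict_mono r" "(mu \<circ> r) \<longlonglongrightarrow> mubar" using accumulation by blast
  have mubar: "mubar \<in> Pset D"
    by (rule closed_sequentially[OF closed_cbox _ r(2)]) (simp add: mu_in_Pset)
  have "(\<lambda>n. g_h D ((mu \<circ> r) n)) \<longlonglongrightarrow> g_h D mubar"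
    unfolding g_h_def
    by (rule crit_tendsto[OF box_le continuous_on_nabla_J_h r(2) mubar]) (simp add: mu_in_Pset)
  moreover have "(\<lambda>n. g_h D ((mu \<circ> r) n)) \<longlonglongrightarrow> 0"
    using LIMSEQ_subseq_LIMSEQ[OF g0 r(1)] by (simp add: o_def)
  ultimately have "g_h D mubar = 0" by (rule LIMSEQ_unique)
  then show ?thesis unfolding g_h_def crit_def .
qed

end
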